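(* Let $f=g+h$ where $g\colon\mathbb{R}^d\to\mathbb{R}$ is $L$-smooth and $\mu$-strongly convex and $h\colon\mathbb{R}^d\to\mathbb{R}\cup\{+\infty\}$ is closed and convex. Let $G$ be a stochastic gradient oracle for $g$ with variance bound $\sigma^2$ and $\mathtt{Alg}$ a procedure as in the context. Fix an arbitrary point $x_{\rm in}\in\mathbb{R}^d$ and let $\Delta_{\rm in}>0$ be any upper bound $\Delta_{\rm in}\ge f(x_{\rm in})-\min f$. Fix $\delta>0$, natural numbers $T,m\in\mathbb{N}$, and an increasing sequence of penalties $0\le\lambda_0\le\dots\le\lambda_T$ (with $\lambda_{-1}:=0$). Then with probability at least $1-2(T+2)\exp\left(-\frac m{18}\right)$, the point $x_{T+1}=\mathtt{BoostAlgC}(\delta,\Delta_{\rm in},x_{\rm in},T,m)$ (defined in the context) satisfies $$f(x_{T+1})-\min f\le\delta\left(1+\sum_{i=0}^T\frac{\lambda_i}{\mu+\lambda_{i-1}}\right).$$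
   Context: $\mu$-strongly convex means $g-\frac\mu2\|\cdot\|^2$ is convex; $L$-smooth means differentiable with $L$-Lipschitz gradient. Stochastic gradient oracle: $(\Omega,\mathcal{F},\mathcal{P})$ is a probability space and $G\colon\mathbb{R}^d\times\Omega\to\mathbb{R}^d$ is measurable with $\mathbb{E}_zG(x,z)=\nabla g(x)$ and $\mathbb{E}_z\|G(x,z)-\nabla g(x)\|^2\le\sigma^2$; for any $x$ one may sample $z\sim\mathcal{P}$ and compute $G(x,z)$. $\mathtt{Alg}$: for $x\in\mathbb{R}^d$, $\lambda\ge0$ let $\varphi_x(y)=g(y)+\frac\lambda2\|y-x\|^2+h(y)$, and let $\Delta>0$ satisfy $\varphi_x(x)-\min\varphi_x\le\Delta$. Then $\mathtt{Alg}(\delta,\lambda,\Delta,x)$ is a randomized procedure that returns a point $y$ satisfying $\mathbb{P}[\varphi_x(y)-\min\varphi_x\le\delta]\ge\frac23$. Different calls are statistically independent. $\mathtt{Extract}(\{y_i\}_{i=1}^m,\rho)$ for a pseudometric $\rho$: for each $i$ let $r_i$ be the smallest $r\ge0$ such that more than $m/2$ of the points $y_k$ satisfy $\rho(y_i,y_k)\le r$; let $\hat r$ be the median of $r_1,\dots,r_m$, meaning the $\lceil m/2\rceil$-th entry in the list sorted in increasing order; return $\{i:r_i\le\hat r\}$. $\mathtt{RobustGap}_\lambda(\mathcal{M},m,\epsilon;x_c)$, for a randomized procedure $\mathcal{M}$, center $x_c$ and $\lambda\ge0$ (robust gap estimation for $f+\frac\lambda2\|\cdot-x_c\|^2$ with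 smooth part $g+\frac\lambda2\|\cdot-x_c\|^2$): put $\mu'=\mu+\lambda$, $L'=L+\lambda$, $\kappa'=L'/\mu'$, $G'(x,z)=G(x,z)+\lambda(x-x_c)$. (1) Generate $u_1,\dots,u_m$ by $m$ independent calls to $\mathcal{M}$. (2) $\mathcal{I}_1=\mathtt{Extract}(\{u_i\},\rho_1)$ with $\rho_1(x,x')=\|x-x'\|$. (3) Fix an arbitrary $i\in\mathcal{I}_1$ and set $\hat x=u_i$. Independently for $k=1,\dots,m$ let $v_k$ be the average of $G'(\hat x,z)$ over $\left\lceil\frac{3\sigma^2}{\kappa'^2\mu'\epsilon}\right\rceil$ fresh i.i.d. samples $z\sim\mathcal{P}$; let $v=v_{k^*}$, where $k^*$ minimizes the smallest radius $r_k\ge0$ such that more than $m/2$ of the points $v_l$ satisfy $\|v_k-v_l\|\le r_k$. (4) $\mathcal{I}_2=\mathtt{Extract}(\{u_i\},\rho_2)$ with $\rho_2(x,x')=|h(x)-h(x')+\langle v,x-x'\rangle|$ on $\operatorname{dom}h$. Return $u_i$ for an arbitrary $i\in\mathcal{I}_1\cap\mathcal{I}_2$. $\mathtt{BoostAlgC}(\delta,\Delta_{\rm in},x_{\rm in},T,m)$: set $\lambda_{-1}=0$, $\Delta_{-1}=\Delta_{\rm in}$, $x_{-1}=x_{\rm in}$. Write $\mathcal{M}_j(\epsilon)=\mathtt{Alg}(\epsilon,\lambda_j,\Delta_j,x_j)$. For $j=0,\dots,T$: set $$x_j=\mathtt{RobustGap}_{\lambda_{j-1}}\bigl(\mathcal{M}_{j-1}(\delta/9),m,\delta/9;x_{j-1}\bigr),\qquad\Delta_j=\delta\left(9\cdot\frac{L+\lambda_{j-1}}{\mu+\lambda_{j-1}}+\sum_{i=0}^{j-1}\frac{\lambda_i}{\mu+\lambda_{i-1}}\right).$$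 Return $x_{T+1}=\mathtt{RobustGap}_{\lambda_T}\bigl(\mathcal{M}_T(\epsilon'),m,\epsilon';x_T\bigr)$ with $\epsilon'=\frac{\delta(\mu+\lambda_T)}{74(L+\lambda_T)}$.
   Formalization: For even m, I_1 and I_2 can be disjoint so RobustGap has no point to return; the claim is literal for odd m, and for every m reads P[bound holds] ≥ P[a point is returned] − 2(T+2)exp(−m/18). If σ=0, one sample is drawn instead of none. *)

theory Defs
  imports "HOL-Probability.Probability"
begin

definition gradient :: "('a::real_inner \<Rightarrow> real) \<Rightarrow> 'a \<Rightarrow> 'a" where
  "gradient g x = (THE D. GDERIV g x :> D)"

definition L_smooth :: "real \<Rightarrow> ('a::real_inner \<Rightarrow> real) \<Rightarrow> bool" where
  "L_smooth L g \<longleftrightarrow> (\<forall>x. GDERIV g x :> gradient g x) \<and> L-lipschitz_on UNIV (gradient g)"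

definition strongly_convex :: "real \<Rightarrow> ('a::real_inner \<Rightarrow> real) \<Rightarrow> bool" where
  "strongly_convex \<mu> g \<longleftrightarrow> convex_on UNIV (\<lambda>x. g x - \<mu> / 2 * (norm x)\<^sup>2)"

definition epi :: "('a \<Rightarrow> ereal) \<Rightarrow> ('a \<times> real) set" where
  "epi h = {(x, r). h x \<le> ereal r}"

definition closed_convex :: "('a::euclidean_space \<Rightarrow> ereal) \<Rightarrow> bool" where
  "closed_convex h \<longleftrightarrow> (\<forall>x. h x \<noteq> -\<infinity>) \<and> closed (epi h) \<and> convex (epi h)"

definition objective :: "('a::real_inner \<Rightarrow> real) \<Rightarrow> ('a \<Rightarrow> ereal) \<Rightarrow> 'a \<Rightarrow> ereal" where
  "objective g h y = ereal (g y) + h y"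

text \<open>Below, \<open>pen\<close> is a single penalty \<open>\<lambda>\<close> and \<open>lam\<close> the sequence of penalties.\<close>

definition prox_objective ::
  "('a::real_inner \<Rightarrow> real) \<Rightarrow> ('a \<Rightarrow> ereal) \<Rightarrow> real \<Rightarrow> 'a \<Rightarrow> 'a \<Rightarrow> ereal" where
  "prox_objective g h pen x y = ereal (g y + pen / 2 * (norm (y - x))\<^sup>2) + h y"

text \<open>In ereal, \<open>\<infinity> - c = \<infinity>\<close> for every \<open>c\<close>, including \<open>c = \<infinity>\<close>. Hence a finite bound on
  \<open>gap \<phi> y\<close> entails that \<open>\<phi> y\<close> is finite; in particular \<open>\<phi>\<close> is then proper.\<close>

definition gap :: "('a \<Rightarrow> ereal) \<Rightarrow> 'a \<Rightarrow> ereal" where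
  "gap \<phi> y = \<phi> y - (INF z. \<phi> z)"

definition stochastic_gradient_oracle ::
  "'z measure \<Rightarrow> ('a::euclidean_space \<Rightarrow> 'z \<Rightarrow> 'a) \<Rightarrow> real \<Rightarrow> ('a \<Rightarrow> real) \<Rightarrow> bool" where
  "stochastic_gradient_oracle P G \<sigma> g \<longleftrightarrow>
     prob_space P \<and>
     (\<lambda>(x, z). G x z) \<in> borel_measurable (borel \<Otimes>\<^sub>M P) \<and>
     (\<forall>x. integrable P (G x) \<and> (\<integral>z. G x z \<partial>P) = gradient g x) \<and>
     (\<forall>x. (\<integral>\<^sup>+z. ennreal ((norm (G x z - gradient g x))\<^sup>2) \<partial>P) \<le> ennreal (\<sigma>\<^sup>2))"

text \<open>A randomized procedure is given by the law of its output, which is a Markov kernel in the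
  input point; this makes calls at random inputs meaningful. Independence of
  different calls is expressed by \<open>bind\<close> and by the product measures below.\<close>

definition alg_procedure :: "('a::euclidean_space \<Rightarrow> real) \<Rightarrow> ('a \<Rightarrow> ereal) \<Rightarrow>
    (real \<Rightarrow> real \<Rightarrow> real \<Rightarrow> 'a \<Rightarrow> 'a measure) \<Rightarrow> bool" where
  "alg_procedure g h Alg \<longleftrightarrow>
     (\<forall>\<delta> pen \<Delta>. 0 < \<delta> \<longrightarrow> 0 \<le> pen \<longrightarrow> 0 < \<Delta> \<longrightarrow>
        Alg \<delta> pen \<Delta> \<in> borel \<rightarrow>\<^sub>M prob_algebra borel \<and>
        (\<forall>x. gap (prox_objective g h pen x) x \<le> ereal \<Delta> \<longrightarrow>
           measure (Alg \<delta> pen \<Delta> x) {y. gap (prox_objective g h pen x) y \<le> ereal \<delta>} \<ge> 2 / 3))"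

text \<open>Pseudometrics take values in \<open>ereal\<close>, because \<open>\<rho>\<^sub>2\<close> below is infinite off \<open>dom h\<close>.\<close>

definition majority_radius :: "nat \<Rightarrow> ('b \<Rightarrow> 'b \<Rightarrow> ereal) \<Rightarrow> (nat \<Rightarrow> 'b) \<Rightarrow> nat \<Rightarrow> ereal" where
  "majority_radius m \<rho> y i =
     (LEAST r. 0 \<le> r \<and> real (card {k. k < m \<and> \<rho> (y i) (y k) \<le> r}) > real m / 2)"

definition median_radius :: "nat \<Rightarrow> ('b \<Rightarrow> 'b \<Rightarrow> ereal) \<Rightarrow> (nat \<Rightarrow> 'b) \<Rightarrow> ereal" where
  "median_radius m \<rho> y = sort (map (majority_radius m \<rho> y) [0..<m]) ! (nat \<lceil>real m / 2\<rceil> - 1)"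

definition Extract :: "nat \<Rightarrow> ('b \<Rightarrow> 'b \<Rightarrow> ereal) \<Rightarrow> (nat \<Rightarrow> 'b) \<Rightarrow> nat set" where
  "Extract m \<rho> y = {i. i < m \<and> majority_radius m \<rho> y i \<le> median_radius m \<rho> y}"

definition rho_norm :: "'a::real_normed_vector \<Rightarrow> 'a \<Rightarrow> ereal" where
  "rho_norm x x' = ereal (norm (x - x'))"

text \<open>The second pseudometric lives on \<open>dom h\<close>. An unsuccessful call of the procedure may return
  a point outside \<open>dom h\<close>; such a point is put at infinite distance.\<close>

definition rho_grad :: "('a::real_inner \<Rightarrow> ereal) \<Rightarrow> 'a \<Rightarrow> 'a \<Rightarrow> 'a \<Rightarrow> ereal" where
  "rho_grad h v x x' =
     (if h x < \<infinity> \<and> h x' < \<infinity>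
      then ereal \<bar>real_of_ereal (h x) - real_of_ereal (h x') + v \<bullet> (x - x')\<bar> else \<infinity>)"

text \<open>At least one sample is drawn, so that the average makes sense also if \<open>\<sigma> = 0\<close>.\<close>

definition sample_size :: "real \<Rightarrow> real \<Rightarrow> real \<Rightarrow> real \<Rightarrow> real \<Rightarrow> nat" where
  "sample_size \<mu> L \<sigma> pen \<epsilon> =
     (let \<mu>' = \<mu> + pen; \<kappa>' = (L + pen) / \<mu>' in max 1 (nat \<lceil>3 * \<sigma>\<^sup>2 / (\<kappa>'\<^sup>2 * \<mu>' * \<epsilon>)\<rceil>))"

text \<open>\<open>grad_average\<close> is \<open>v\<^sub>k\<close>, computed at \<open>x\<close> from the samples \<open>Z k 0, \<dots>, Z k (N - 1)\<close>.\<close>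

definition grad_average :: "('a::real_normed_vector \<Rightarrow> 'z \<Rightarrow> 'a) \<Rightarrow> real \<Rightarrow> 'a \<Rightarrow> nat \<Rightarrow> 'a \<Rightarrow>
    (nat \<Rightarrow> nat \<Rightarrow> 'z) \<Rightarrow> nat \<Rightarrow> 'a" where
  "grad_average G pen x\<^sub>c N x Z k = (\<Sum>n<N. G x (Z k n) + pen *\<^sub>R (x - x\<^sub>c)) /\<^sub>R real N"

definition center_set :: "nat \<Rightarrow> (nat \<Rightarrow> 'a::real_normed_vector) \<Rightarrow> nat set" where
  "center_set m v = {k. is_arg_min (majority_radius m rho_norm v) (\<lambda>k. k < m) k}"

text \<open>The arbitrary choices made in one run of RobustGap: the index of \<open>x\<close>-hat, the minimizer \<open>k\<^sup>*\<close>,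
  and the returned index. Each may depend on everything seen so far in the run (center \<open>x\<^sub>c\<close>,
  candidates \<open>u\<close>, samples \<open>Z\<close>, earlier choices) and may itself be randomized; it may not depend on
  samples that have not been drawn yet.\<close>

record ('a, 'z) choices =
  pick_point :: "'a \<Rightarrow> (nat \<Rightarrow> 'a) \<Rightarrow> nat pmf"
  pick_grad :: "'a \<Rightarrow> (nat \<Rightarrow> 'a) \<Rightarrow> nat \<Rightarrow> (nat \<Rightarrow> nat \<Rightarrow> 'z) \<Rightarrow> nat pmf"
  pick_output :: "'a \<Rightarrow> (nat \<Rightarrow> 'a) \<Rightarrow> nat \<Rightarrow> (nat \<Rightarrow> nat \<Rightarrow> 'z) \<Rightarrow> nat \<Rightarrow> nat pmf"

text \<open>No condition is imposed where there is nothing to choose from.\<close>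

definition picks_from :: "nat pmf \<Rightarrow> nat set \<Rightarrow> bool" where
  "picks_from p I \<longleftrightarrow> (I \<noteq> {} \<longrightarrow> set_pmf p \<subseteq> I)"

definition admissible_choices ::
  "real \<Rightarrow> real \<Rightarrow> real \<Rightarrow> 'z measure \<Rightarrow> ('a::euclidean_space \<Rightarrow> 'z \<Rightarrow> 'a) \<Rightarrow> ('a \<Rightarrow> ereal) \<Rightarrow> nat \<Rightarrow>
    real \<Rightarrow> real \<Rightarrow> ('a, 'z) choices \<Rightarrow> bool" where
  "admissible_choices \<mu> L \<sigma> P G h m pen \<epsilon> c \<longleftrightarrow>
     (let N = sample_size \<mu> L \<sigma> pen \<epsilon>;
          U = PiM {..<m} (\<lambda>_. borel);
          S = PiM {..<m} (\<lambda>_. PiM {..<N} (\<lambda>_. P));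
          K = prob_algebra (count_space UNIV)
      in (\<lambda>(x\<^sub>c, u). measure_pmf (pick_point c x\<^sub>c u)) \<in> borel \<Otimes>\<^sub>M U \<rightarrow>\<^sub>M K \<and>
         (\<forall>i. (\<lambda>(x\<^sub>c, u, Z). measure_pmf (pick_grad c x\<^sub>c u i Z)) \<in> borel \<Otimes>\<^sub>M U \<Otimes>\<^sub>M S \<rightarrow>\<^sub>M K) \<and>
         (\<forall>i k. (\<lambda>(x\<^sub>c, u, Z). measure_pmf (pick_output c x\<^sub>c u i Z k)) \<in> borel \<Otimes>\<^sub>M U \<Otimes>\<^sub>M S \<rightarrow>\<^sub>M K) \<and>
         (\<forall>x\<^sub>c. \<forall>u \<in> space U. picks_from (pick_point c x\<^sub>c u) (Extract m rho_norm u)) \<and>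
         (\<forall>x\<^sub>c. \<forall>u \<in> space U. \<forall>i < m. \<forall>Z \<in> space S.
            picks_from (pick_grad c x\<^sub>c u i Z) (center_set m (grad_average G pen x\<^sub>c N (u i) Z))) \<and>
         (\<forall>x\<^sub>c. \<forall>u \<in> space U. \<forall>i < m. \<forall>Z \<in> space S. \<forall>k < m.
            picks_from (pick_output c x\<^sub>c u i Z k)
              (Extract m rho_norm u \<inter>
               Extract m (rho_grad h (grad_average G pen x\<^sub>c N (u i) Z k)) u)))"

text \<open>The law of the returned point. For even \<open>m\<close> the two extracted index sets may consist of
  exactly \<open>m/2\<close> indices each and be disjoint, so that there is no index to return. Such a run returns
  nothing: its mass is missing from the law, which is therefore a subprobability measure in general.
  For odd \<open>m\<close> the two sets always intersect.\<close>

definition RobustGap ::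
  "real \<Rightarrow> real \<Rightarrow> real \<Rightarrow> 'z measure \<Rightarrow> ('a::euclidean_space \<Rightarrow> 'z \<Rightarrow> 'a) \<Rightarrow> ('a \<Rightarrow> ereal) \<Rightarrow>
    ('a, 'z) choices \<Rightarrow> real \<Rightarrow> 'a measure \<Rightarrow> nat \<Rightarrow> real \<Rightarrow> 'a \<Rightarrow> 'a measure" where
  "RobustGap \<mu> L \<sigma> P G h c pen M m \<epsilon> x\<^sub>c =
     (let N = sample_size \<mu> L \<sigma> pen \<epsilon> in
      do {
        u \<leftarrow> PiM {..<m} (\<lambda>_. M);
        i \<leftarrow> measure_pmf (pick_point c x\<^sub>c u);
        Z \<leftarrow> PiM {..<m} (\<lambda>_. PiM {..<N} (\<lambda>_. P));
        k \<leftarrow> measure_pmf (pick_grad c x\<^sub>c u i Z);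
        let v = grad_average G pen x\<^sub>c N (u i) Z k;
        let I\<^sub>1 = Extract m rho_norm u;
        let I\<^sub>2 = Extract m (rho_grad h v) u;
        if I\<^sub>1 \<inter> I\<^sub>2 = {} then null_measure borel
        else do {
          l \<leftarrow> measure_pmf (pick_output c x\<^sub>c u i Z k);
          return borel (u l)
        }
      })"

text \<open>The recursion starts at index \<open>-1\<close>: \<open>lam_prev lam j\<close> and \<open>Delta_prev \<dots> j\<close> are
  \<open>\<lambda>\<^sub>j\<^sub>-\<^sub>1\<close> and \<open>\<Delta>\<^sub>j\<^sub>-\<^sub>1\<close>.\<close>

definition lam_prev :: "(nat \<Rightarrow> real) \<Rightarrow> nat \<Rightarrow> real" where
  "lam_prev lam j = (case j of 0 \<Rightarrow> 0 | Suc i \<Rightarrow> lam i)"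

definition Delta :: "real \<Rightarrow> real \<Rightarrow> real \<Rightarrow> (nat \<Rightarrow> real) \<Rightarrow> nat \<Rightarrow> real" where
  "Delta \<mu> L \<delta> lam j =
     \<delta> * (9 * ((L + lam_prev lam j) / (\<mu> + lam_prev lam j)) + (\<Sum>i<j. lam i / (\<mu> + lam_prev lam i)))"

definition Delta_prev :: "real \<Rightarrow> real \<Rightarrow> real \<Rightarrow> real \<Rightarrow> (nat \<Rightarrow> real) \<Rightarrow> nat \<Rightarrow> real" where
  "Delta_prev \<mu> L \<delta> \<Delta>in lam j = (case j of 0 \<Rightarrow> \<Delta>in | Suc i \<Rightarrow> Delta \<mu> L \<delta> lam i)"

definition final_accuracy :: "real \<Rightarrow> real \<Rightarrow> real \<Rightarrow> (nat \<Rightarrow> real) \<Rightarrow> nat \<Rightarrow> real" where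
  "final_accuracy \<mu> L \<delta> lam T = \<delta> * (\<mu> + lam T) / (74 * (L + lam T))"

text \<open>\<open>boost_iterate \<dots> j\<close> is the law of \<open>x\<^sub>j\<^sub>-\<^sub>1\<close>; the point \<open>x\<^sub>j\<close> is computed by call number \<open>j\<close> of
  RobustGap, with choices \<open>c j\<close>.\<close>

primrec boost_iterate ::
  "real \<Rightarrow> real \<Rightarrow> real \<Rightarrow> 'z measure \<Rightarrow> ('a::euclidean_space \<Rightarrow> 'z \<Rightarrow> 'a) \<Rightarrow> ('a \<Rightarrow> ereal) \<Rightarrow>
    (real \<Rightarrow> real \<Rightarrow> real \<Rightarrow> 'a \<Rightarrow> 'a measure) \<Rightarrow> (nat \<Rightarrow> ('a, 'z) choices) \<Rightarrow> (nat \<Rightarrow> real) \<Rightarrow>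
    real \<Rightarrow> real \<Rightarrow> 'a \<Rightarrow> nat \<Rightarrow> nat \<Rightarrow> 'a measure" where
  "boost_iterate \<mu> L \<sigma> P G h Alg c lam \<delta> \<Delta>in xin m 0 = return borel xin"
| "boost_iterate \<mu> L \<sigma> P G h Alg c lam \<delta> \<Delta>in xin m (Suc j) =
     do {
       x \<leftarrow> boost_iterate \<mu> L \<sigma> P G h Alg c lam \<delta> \<Delta>in xin m j;
       RobustGap \<mu> L \<sigma> P G h (c j) (lam_prev lam j)
         (Alg (\<delta> / 9) (lam_prev lam j) (Delta_prev \<mu> L \<delta> \<Delta>in lam j) x) m (\<delta> / 9) x
     }"

definition BoostAlgC ::
  "real \<Rightarrow> real \<Rightarrow> real \<Rightarrow> 'z measure \<Rightarrow> ('a::euclidean_space \<Rightarrow> 'z \<Rightarrow> 'a) \<Rightarrow> ('a \<Rightarrow> ereal) \<Rightarrow>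
    (real \<Rightarrow> real \<Rightarrow> real \<Rightarrow> 'a \<Rightarrow> 'a measure) \<Rightarrow> (nat \<Rightarrow> ('a, 'z) choices) \<Rightarrow> (nat \<Rightarrow> real) \<Rightarrow>
    real \<Rightarrow> real \<Rightarrow> 'a \<Rightarrow> nat \<Rightarrow> nat \<Rightarrow> 'a measure" where
  "BoostAlgC \<mu> L \<sigma> P G h Alg c lam \<delta> \<Delta>in xin T m =
     (let \<epsilon>' = final_accuracy \<mu> L \<delta> lam T in
      do {
        x \<leftarrow> boost_iterate \<mu> L \<sigma> P G h Alg c lam \<delta> \<Delta>in xin m (T + 1);
        RobustGap \<mu> L \<sigma> P G h (c (T + 1)) (lam T) (Alg \<epsilon>' (lam T) (Delta \<mu> L \<delta> lam T) x) m \<epsilon>' x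
      })"

end

theory Submission
  imports Defs
begin

text \<open>
  A single run of \<open>RobustGap\<close> with center \<open>x\<^sub>c\<close> fails with probability at most \<open>2 exp (-m/18)\<close>.
  By Hoeffding's inequality more than half of the candidates \<open>u\<^sub>i\<close> have gap at most \<open>\<epsilon>\<close>, and, given the
  candidates, more than half of the averages \<open>v\<^sub>k\<close> are within \<open>a = \<kappa>' sqrt (\<mu>' \<epsilon>)\<close> of the gradient at
  \<open>x\<close>-hat (each of them with probability at least 2/3, by Chebyshev's inequality).
  A majority ball meets the majority of good points, so every point that survives an extraction is
  at most three times as far from the target as the good points are. Let \<open>r = sqrt (2\<epsilon>/\<mu>')\<close> bound the
  distance of a good candidate from the minimizer \<open>xb\<close>. The returned point is then within \<open>3r\<close> of \<open>xb\<close>,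
  the gradient estimate \<open>v\<close> is within \<open>W = 3a + 3L'r\<close> of the gradient at \<open>xb\<close>, and
  the values \<open>h x + v \<bullet> x\<close> at the returned point and at \<open>xb\<close> differ by at most \<open>3(\<epsilon> + W r)\<close>.
  Replacing \<open>v\<close> by the gradient at \<open>xb\<close> and using \<open>L'\<close>-smoothness, the gap of the returned point is at
  most \<open>3\<epsilon> + 6 W r + 9\<kappa>'\<epsilon> \<le> 74 \<kappa>' \<epsilon>\<close>.

  For the outer loop, the minimal value of \<open>f + \<lambda>\<^sub>j/2 \<parallel>\<cdot> - x\<^sub>j\<parallel>\<^sup>2\<close> is at most the value at the minimizer of
  the previous proximal problem. It therefore exceeds the previous minimal value by at most
  \<open>\<lambda>\<^sub>j/2 \<cdot> 9r\<^sup>2 = \<delta> \<lambda>\<^sub>j / (\<mu> + \<lambda>\<^sub>j\<^sub>-\<^sub>1)\<close>, and these increments sum to the stated bound.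
\<close>

section \<open>Smooth strongly convex composite functions\<close>

lemma L_smooth_has_derivative_line:
  assumes "L_smooth L g"
  shows "((\<lambda>t. g (x + t *\<^sub>R d)) has_real_derivative (gradient g (x + t *\<^sub>R d) \<bullet> d)) (at t)"
proof -
  have "(g has_derivative (\<lambda>h. h \<bullet> gradient g (x + t *\<^sub>R d))) (at (x + t *\<^sub>R d))"
    using assms unfolding L_smooth_def gderiv_def by blast
  then have "((\<lambda>t. g (x + t *\<^sub>R d)) has_derivative
      (\<lambda>s. (s *\<^sub>R d) \<bullet> gradient g (x + t *\<^sub>R d))) (at t)"
    by (rule has_derivative_compose[rotated]) (auto intro!: derivative_eq_intros)
  then show ?thesis
    by (simp add: has_field_derivative_def inner_commute mult_commute_abs)
qed

text \<open>Descent lemma: along the segment from \<open>x\<close> to \<open>y\<close>, the error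
  \<open>\<psi>\<close> of the quadratic model has nonpositive derivative by Cauchy-Schwarz and the
  Lipschitz gradient, so its value at 1 is at most its value at 0.\<close>

lemma L_smooth_quadratic_upper:
  assumes "L_smooth L g"
  shows "g y \<le> g x + gradient g x \<bullet> (y - x) + L / 2 * (norm (y - x))\<^sup>2"
proof -
  define d where "d = y - x"
  define \<psi> where "\<psi> t = g (x + t *\<^sub>R d) - t * (gradient g x \<bullet> d) - L / 2 * t\<^sup>2 * (norm d)\<^sup>2" for t
  have lip: "norm (gradient g a - gradient g b) \<le> L * norm (a - b)" for a b
    using assms by (auto simp: L_smooth_def lipschitz_on_def dist_norm)
  have "\<psi> 1 \<le> \<psi> 0"
  proof (rule DERIV_nonpos_imp_nonincreasing[of 0 1 \<psi>])
    fix t :: real assume t: "0 \<le> t" "t \<le> 1"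
    let ?D = "gradient g (x + t *\<^sub>R d) \<bullet> d - gradient g x \<bullet> d - L * t * (norm d)\<^sup>2"
    have "(\<psi> has_real_derivative ?D) (at t)"
      unfolding \<psi>_def
      by (rule derivative_eq_intros refl L_smooth_has_derivative_line[OF assms] | simp)+
    moreover have "?D \<le> 0"
    proof -
      have "gradient g (x + t *\<^sub>R d) \<bullet> d - gradient g x \<bullet> d = (gradient g (x + t *\<^sub>R d) - gradient g x) \<bullet> d"
        by (simp add: inner_diff_left)
      also have "\<dots> \<le> norm (gradient g (x + t *\<^sub>R d) - gradient g x) * norm d"
        by (rule norm_cauchy_schwarz)
      also have "\<dots> \<le> L * norm (t *\<^sub>R d) * norm d"
        using lip[of "x + t *\<^sub>R d" x] by (intro mult_right_mono) auto
      also have "\<dots> = L * t * (norm d)\<^sup>2"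
        using t by (simp add: power2_eq_square)
      finally show ?thesis by simp
    qed
    ultimately show "\<exists>D. DERIV \<psi> t :> D \<and> D \<le> 0" by blast
  qed simp
  then show ?thesis by (simp add: \<psi>_def d_def)
qed

text \<open>Restricted to the line through \<open>x\<close> and \<open>y\<close>, the convex
  function \<open>g - \<mu>/2 |.|^2\<close> lies above its tangent at \<open>x\<close>; expanding
  the square along the line leaves exactly the quadratic term in \<open>d\<close>.\<close>

lemma strongly_convex_quadratic_lower:
  assumes "L_smooth L g" "strongly_convex \<mu> g"
  shows "g x + gradient g x \<bullet> (y - x) + \<mu> / 2 * (norm (y - x))\<^sup>2 \<le> g y"
proof -
  define d where "d = y - x"
  define k where "k t = g (x + t *\<^sub>R d) - \<mu> / 2 * (norm (x + t *\<^sub>R d))\<^sup>2" for t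
  have sq: "(norm (x + t *\<^sub>R d))\<^sup>2 = (norm x)\<^sup>2 + 2 * t * (x \<bullet> d) + t\<^sup>2 * (norm d)\<^sup>2" for t
    unfolding power2_norm_eq_inner
    by (simp add: inner_add_left inner_add_right inner_commute power2_eq_square algebra_simps)
  have "convex_on UNIV k"
  proof (rule convex_onI)
    fix t a b :: real assume t: "0 < t" "t < 1"
    have eq: "x + ((1 - t) *\<^sub>R a + t *\<^sub>R b) *\<^sub>R d = (1 - t) *\<^sub>R (x + a *\<^sub>R d) + t *\<^sub>R (x + b *\<^sub>R d)"
      by (simp add: algebra_simps)
    show "k ((1 - t) *\<^sub>R a + t *\<^sub>R b) \<le> (1 - t) * k a + t * k b"
      unfolding k_def eq
      using convex_onD[OF assms(2)[unfolded strongly_convex_def], of t "x + a *\<^sub>R d" "x + b *\<^sub>R d"] t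
      by simp
  qed simp
  moreover have "(k has_real_derivative (gradient g x \<bullet> d - \<mu> * (x \<bullet> d))) (at 0)"
  proof -
    have "((\<lambda>t. g (x + t *\<^sub>R d)) has_real_derivative gradient g x \<bullet> d) (at 0)"
      using L_smooth_has_derivative_line[OF assms(1), of x d 0] by simp
    moreover have "((\<lambda>t. \<mu> / 2 * ((norm x)\<^sup>2 + 2 * t * (x \<bullet> d) + t\<^sup>2 * (norm d)\<^sup>2))
        has_real_derivative \<mu> * (x \<bullet> d)) (at 0)"
      by (auto intro!: derivative_eq_intros)
    ultimately show ?thesis
      unfolding k_def sq by (rule DERIV_diff)
  qed
  ultimately have "k 1 - k 0 \<ge> (gradient g x \<bullet> d - \<mu> * (x \<bullet> d)) * (1 - 0)"
    by (intro convex_on_imp_above_tangent[where A = UNIV]) auto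
  then have "gradient g x \<bullet> d - \<mu> * (x \<bullet> d) \<le> g (x + d) - \<mu> / 2 * (norm (x + d))\<^sup>2 - (g x - \<mu> / 2 * (norm x)\<^sup>2)"
    by (simp add: k_def)
  moreover have "\<mu> / 2 * (norm (x + d))\<^sup>2 = \<mu> / 2 * (norm x)\<^sup>2 + \<mu> * (x \<bullet> d) + \<mu> / 2 * (norm d)\<^sup>2"
    using sq[of 1] by (simp add: algebra_simps)
  ultimately have "g x + gradient g x \<bullet> d + \<mu> / 2 * (norm d)\<^sup>2 \<le> g (x + d)"
    by argo
  then show ?thesis by (simp add: d_def)
qed

text \<open>The gradient field \<open>D\<close> is a parameter, so that adding a quadratic penalty
  yields a new instance by algebra, with no need to differentiate the penalized function.\<close>

locale smooth_strongly_convex =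
  fixes g :: "'a::euclidean_space \<Rightarrow> real" and D :: "'a \<Rightarrow> 'a" and \<mu> L :: real
  assumes mu_pos: "0 < \<mu>"
    and lower: "g x + D x \<bullet> (y - x) + \<mu> / 2 * (norm (y - x))\<^sup>2 \<le> g y"
    and upper: "g y \<le> g x + D x \<bullet> (y - x) + L / 2 * (norm (y - x))\<^sup>2"
    and lipschitz: "norm (D x - D y) \<le> L * norm (x - y)"
begin

lemma mu_le_L: "\<mu> \<le> L"
proof -
  obtain b :: 'a where "b \<in> Basis" using nonempty_Basis by blast
  then show ?thesis using lower[of 0 b] upper[of b 0] by simp
qed

lemma L_pos: "0 < L"
  using mu_le_L mu_pos by simp

text \<open>Continuity follows by squeezing \<open>g\<close> between its two quadratic models at the
  limit point.\<close>

lemma tendsto_compose: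
  assumes "X \<longlonglongrightarrow> x"
  shows "(\<lambda>n. g (X n)) \<longlonglongrightarrow> g x"
proof (rule tendsto_sandwich)
  show "(\<lambda>n. g x + D x \<bullet> (X n - x) + \<mu> / 2 * (norm (X n - x))\<^sup>2) \<longlonglongrightarrow> g x"
    by (rule tendsto_eq_intros assms refl | simp)+
  show "(\<lambda>n. g x + D x \<bullet> (X n - x) + L / 2 * (norm (X n - x))\<^sup>2) \<longlonglongrightarrow> g x"
    by (rule tendsto_eq_intros assms refl | simp)+
qed (use lower[of x] upper[of _ x] in \<open>auto intro!: always_eventually\<close>)

text \<open>The penalty coincides with its own second-order expansion at any point, so it shifts
  both curvature constants by exactly \<open>pen\<close>.\<close>

lemma regularized:
  assumes "0 \<le> pen"
  shows "smooth_strongly_convex (\<lambda>y. g y + pen / 2 * (norm (y - c))\<^sup>2) (\<lambda>y. D y + pen *\<^sub>R (y - c))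
    (\<mu> + pen) (L + pen)"
proof
  have sq: "(norm (y - c))\<^sup>2 = (norm (x - c))\<^sup>2 + 2 * ((x - c) \<bullet> (y - x)) + (norm (y - x))\<^sup>2" for x y
    unfolding power2_norm_eq_inner
    by (simp add: inner_diff_left inner_diff_right inner_commute algebra_simps)
  have eq: "pen / 2 * (norm (y - c))\<^sup>2 =
      pen / 2 * (norm (x - c))\<^sup>2 + (pen *\<^sub>R (x - c)) \<bullet> (y - x) + pen / 2 * (norm (y - x))\<^sup>2" for x y
    by (subst sq[of y x]) (simp add: algebra_simps)
  show "0 < \<mu> + pen" using mu_pos assms by simp
  fix x y
  show "g x + pen / 2 * (norm (x - c))\<^sup>2 + (D x + pen *\<^sub>R (x - c)) \<bullet> (y - x)
      + (\<mu> + pen) / 2 * (norm (y - x))\<^sup>2 \<le> g y + pen / 2 * (norm (y - c))\<^sup>2"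
    unfolding eq[of y x] inner_add_left add_divide_distrib distrib_right using lower[of x y] by argo
  show "g y + pen / 2 * (norm (y - c))\<^sup>2 \<le> g x + pen / 2 * (norm (x - c))\<^sup>2
      + (D x + pen *\<^sub>R (x - c)) \<bullet> (y - x) + (L + pen) / 2 * (norm (y - x))\<^sup>2"
    unfolding eq[of y x] inner_add_left add_divide_distrib distrib_right using upper[of y x] by argo
  have "norm (D x + pen *\<^sub>R (x - c) - (D y + pen *\<^sub>R (y - c))) = norm ((D x - D y) + pen *\<^sub>R (x - y))"
    by (simp add: algebra_simps)
  also have "\<dots> \<le> norm (D x - D y) + norm (pen *\<^sub>R (x - y))"
    by (rule norm_triangle_ineq)
  also have "\<dots> \<le> (L + pen) * norm (x - y)"
    using lipschitz[of x y] assms by (simp add: distrib_right)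
  finally show "norm (D x + pen *\<^sub>R (x - c) - (D y + pen *\<^sub>R (y - c))) \<le> (L + pen) * norm (x - y)" .
qed

end

lemma smooth_strongly_convex_gradient:
  assumes "0 < \<mu>" "L_smooth L g" "strongly_convex \<mu> g"
  shows "smooth_strongly_convex g (gradient g) \<mu> L"
proof
  show "norm (gradient g x - gradient g y) \<le> L * norm (x - y)" for x y
    using assms(2) by (auto simp: L_smooth_def lipschitz_on_def dist_norm)
qed (rule assms(1) L_smooth_quadratic_upper[OF assms(2)] strongly_convex_quadratic_lower[OF assms(2,3)])+

section \<open>Closed convex functions and optimality gaps\<close>

lemma closed_convex_convexD:
  assumes "closed_convex h" "h x \<le> ereal r" "h y \<le> ereal s" "0 \<le> t" "t \<le> 1"
  shows "h ((1 - t) *\<^sub>R x + t *\<^sub>R y) \<le> ereal ((1 - t) * r + t * s)"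
proof -
  have "(1 - t) *\<^sub>R (x, r) + t *\<^sub>R (y, s) \<in> epi h"
    using assms by (intro convexD_alt) (auto simp: closed_convex_def epi_def)
  then show ?thesis by (simp add: epi_def)
qed

lemma closed_convex_limitD:
  assumes "closed_convex h" "\<And>n. h (X n) \<le> ereal (R n)" "X \<longlonglongrightarrow> x" "R \<longlonglongrightarrow> r"
  shows "h x \<le> ereal r"
proof -
  have "(x, r) \<in> epi h"
  proof (rule closed_sequentially)
    show "(\<lambda>n. (X n, R n)) \<longlonglongrightarrow> (x, r)" using assms by (intro tendsto_Pair)
  qed (use assms in \<open>auto simp: closed_convex_def epi_def\<close>)
  then show ?thesis by (simp add: epi_def)
qed

lemma closed_convex_borel_measurable [measurable]:
  assumes "closed_convex h"
  shows "h \<in> borel_measurable borel"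
proof (rule borel_measurableI_le)
  fix a
  have "closed {x. h x \<le> a}"
  proof (cases a)
    case (real r)
    \<comment> \<open>A real sublevel set is a horizontal slice of the closed epigraph.\<close>
    have "closed ((\<lambda>x. (x, r)) -` epi h)"
      using assms by (intro closed_vimage) (auto simp: closed_convex_def intro!: continuous_intros)
    then show ?thesis by (simp add: epi_def vimage_def real)
  qed (use assms in \<open>auto simp: closed_convex_def\<close>)
  then show "{x \<in> space borel. h x \<le> a} \<in> sets borel" by auto
qed

lemma objective_le_iff: "objective g h x \<le> ereal a \<longleftrightarrow> h x \<le> ereal (a - g x)"
  by (cases "h x") (auto simp: objective_def)

text \<open>Both infinite values of the infimum are excluded: if it is \<infinity> then so is the
  value at \<open>x\<close>, and \<infinity> - \<infinity> = \<infinity> in \<open>ereal\<close>; if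
  it is -\<infinity> then subtracting it gives an infinite gap.\<close>

lemma gap_leD:
  assumes "gap \<phi> x \<le> ereal e" "\<And>y. \<phi> y \<noteq> -\<infinity>"
  obtains v where "(INF y. \<phi> y) = ereal v" "\<phi> x \<le> ereal (v + e)"
proof (cases "INF y. \<phi> y")
  case (real v)
  with assms(1) have "\<phi> x \<le> ereal (v + e)"
    by (cases "\<phi> x") (auto simp: gap_def)
  with real show ?thesis by (rule that)
next
  case PInf
  have "(INF y. \<phi> y) \<le> \<phi> x" by (rule INF_lower) simp
  with PInf have "\<phi> x = \<infinity>" by simp
  with PInf show ?thesis using assms(1) by (simp add: gap_def)
next
  case MInf
  then show ?thesis using assms by (cases "\<phi> x") (auto simp: gap_def)
qed

lemma gap_le_iff:
  assumes "(INF y. \<phi> y) = ereal v"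
  shows "gap \<phi> x \<le> ereal e \<longleftrightarrow> \<phi> x \<le> ereal (v + e)"
  unfolding gap_def assms by (cases "\<phi> x") (auto simp: algebra_simps)

lemma prox_objective_eq:
  "prox_objective g h pen c = objective (\<lambda>y. g y + pen / 2 * (norm (y - c))\<^sup>2) h"
  by (simp add: prox_objective_def objective_def fun_eq_iff)

text \<open>Divide by \<open>t\<close> and let \<open>t\<close> tend to 0 from the right. This
  extracts the first-order optimality condition in \<open>excess_nonneg\<close>.\<close>

lemma nonneg_if_quadratic_nonneg:
  fixes a b :: real
  assumes "\<And>t. 0 < t \<Longrightarrow> t < 1 \<Longrightarrow> 0 \<le> t * a + t\<^sup>2 * b"
  shows "0 \<le> a"
proof (rule tendsto_lowerbound)
  show "((\<lambda>t. a + t * b) \<longlongrightarrow> a) (at_right 0)"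
    by (rule tendsto_eq_intros refl | simp)+
  have "0 \<le> a + t * b" if "0 < t" "t < 1" for t
  proof -
    have "0 \<le> t * (a + t * b)"
      using assms[OF that] by (simp add: algebra_simps power2_eq_square)
    then show ?thesis using that by (simp add: zero_le_mult_iff)
  qed
  then show "\<forall>\<^sub>F t in at_right 0. 0 \<le> a + t * b"
    by (intro eventually_at_rightI[of 0 1]) auto
qed simp

section \<open>Composite objectives and their minimizers\<close>

locale composite = smooth_strongly_convex g D \<mu> L
  for g :: "'a::euclidean_space \<Rightarrow> real" and D \<mu> L +
  fixes h :: "'a \<Rightarrow> ereal"
  assumes closed_convex_h: "closed_convex h"
begin

text \<open>The lower quadratic bound at the midpoint is applied towards both endpoints; the two
  linear terms cancel because the displacements are opposite.\<close>

lemma objective_midpoint: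
  assumes "objective g h x \<le> ereal a" "objective g h y \<le> ereal b"
  shows "objective g h ((1 / 2) *\<^sub>R (x + y)) \<le> ereal ((a + b) / 2 - \<mu> / 8 * (norm (x - y))\<^sup>2)"
proof -
  define z where "z = (1 / 2) *\<^sub>R (x + y)"
  have h: "h z \<le> ereal ((1 - 1 / 2) * (a - g x) + 1 / 2 * (b - g y))"
    using closed_convex_convexD[OF closed_convex_h, of x "a - g x" y "b - g y" "1 / 2"] assms
    by (simp add: z_def objective_le_iff scaleR_add_right)
  have x: "x - z = (1 / 2) *\<^sub>R (x - y)" and y: "y - z = (- (1 / 2)) *\<^sub>R (x - y)"
    unfolding z_def by (rule euclidean_eqI; simp add: inner_diff_left inner_add_left field_simps)+
  have nx: "(norm (x - z))\<^sup>2 = (norm (x - y))\<^sup>2 / 4" and ny: "(norm (y - z))\<^sup>2 = (norm (x - y))\<^sup>2 / 4"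
    unfolding x y by (simp_all add: power_divide)
  have "D z \<bullet> (y - z) = - (D z \<bullet> (x - z))"
    unfolding x y by simp
  with lower[of z x] lower[of z y] have "g z \<le> (g x + g y) / 2 - \<mu> / 8 * (norm (x - y))\<^sup>2"
    unfolding nx ny by argo
  with h show ?thesis
    unfolding z_def[symmetric] objective_le_iff by (elim order_trans) (simp, argo)
qed

text \<open>A midpoint cannot have a value below the infimum, so \<open>objective_midpoint\<close>
  bounds the distance of two nearly optimal points and every minimizing sequence is Cauchy.
  Closedness of the epigraph puts the limit at the minimal value.\<close>

lemma minimizer_exists:
  assumes v: "(INF y. objective g h y) = ereal v"
  obtains xb where "objective g h xb = ereal v"
proof -
  define a where "a n = 1 / real (Suc n)" for n
  have a_pos: "0 < a n" for n by (simp add: a_def)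
  have a_le: "a i \<le> a n" if "n \<le> i" for i n
    unfolding a_def using that by (intro divide_left_mono) auto
  have a_lim: "a \<longlonglongrightarrow> 0"
    unfolding a_def by (rule LIMSEQ_Suc[OF lim_1_over_n])
  have "\<exists>x. objective g h x \<le> ereal (v + a n)" for n
  proof -
    have "(INF y. objective g h y) < ereal (v + a n)"
      unfolding v using a_pos by simp
    then show ?thesis by (auto simp: INF_less_iff intro: less_imp_le)
  qed
  then obtain X where X: "\<And>n. objective g h (X n) \<le> ereal (v + a n)"
    by metis
  have close: "\<mu> / 8 * (norm (X i - X k))\<^sup>2 \<le> a n" if "n \<le> i" "n \<le> k" for i k n
  proof -
    have "ereal v \<le> objective g h ((1 / 2) *\<^sub>R (X i + X k))"
      unfolding v[symmetric] by (rule INF_lower) simp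
    also have "\<dots> \<le> ereal (((v + a i) + (v + a k)) / 2 - \<mu> / 8 * (norm (X i - X k))\<^sup>2)"
      by (rule objective_midpoint[OF X X])
    finally show ?thesis
      using a_le[OF that(1)] a_le[OF that(2)] unfolding ereal_less_eq by argo
  qed
  have "Cauchy X"
  proof (rule metric_CauchyI)
    fix e :: real assume "0 < e"
    then obtain n where n: "a n < \<mu> / 8 * e\<^sup>2"
      using reals_Archimedean[of "\<mu> / 8 * e\<^sup>2"] mu_pos by (auto simp: a_def inverse_eq_divide)
    have "dist (X i) (X k) < e" if "n \<le> i" "n \<le> k" for i k
    proof -
      have "\<mu> / 8 * (norm (X i - X k))\<^sup>2 < \<mu> / 8 * e\<^sup>2"
        using close[OF that] n by linarith
      then have "(norm (X i - X k))\<^sup>2 < e\<^sup>2" using mu_pos by simp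
      then show ?thesis using \<open>0 < e\<close> by (simp add: dist_norm power2_less_imp_less)
    qed
    then show "\<exists>M. \<forall>m\<ge>M. \<forall>n\<ge>M. dist (X m) (X n) < e" by blast
  qed
  then obtain xb where xb: "X \<longlonglongrightarrow> xb"
    using Cauchy_convergent convergent_def by blast
  have "h xb \<le> ereal (v - g xb)"
  proof (rule closed_convex_limitD[OF closed_convex_h _ xb])
    show "h (X n) \<le> ereal (v + a n - g (X n))" for n
      using X[of n] by (simp add: objective_le_iff)
    have "(\<lambda>n. v + a n - g (X n)) \<longlonglongrightarrow> v + 0 - g xb"
      by (intro tendsto_intros tendsto_compose xb a_lim)
    then show "(\<lambda>n. v + a n - g (X n)) \<longlonglongrightarrow> v - g xb" by simp
  qed
  then have "objective g h xb \<le> ereal v" by (simp add: objective_le_iff)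
  moreover have "ereal v \<le> objective g h xb"
    unfolding v[symmetric] by (rule INF_lower) simp
  ultimately have "objective g h xb = ereal v" by (rule antisym)
  then show ?thesis by (rule that)
qed

text \<open>The part of the gap at \<open>u\<close> that is due to \<open>h\<close>, with \<open>g\<close> linearized at the minimizer \<open>xb\<close>.\<close>

definition excess :: "'a \<Rightarrow> 'a \<Rightarrow> real" where
  "excess xb u = real_of_ereal (h u) - real_of_ereal (h xb) + D xb \<bullet> (u - xb)"

context
  fixes v :: real and xb :: 'a
  assumes v: "(INF y. objective g h y) = ereal v" and xb: "objective g h xb = ereal v"
begin

lemma h_minimizer: "h xb = ereal (v - g xb)"
  using xb by (cases "h xb") (auto simp: objective_def)

lemma h_finite:
  assumes "h u < \<infinity>"
  obtains r where "h u = ereal r"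
  using assms closed_convex_h by (cases "h u") (auto simp: closed_convex_def)

text \<open>First-order optimality of \<open>xb\<close>: moving from \<open>xb\<close> towards
  \<open>u\<close> by a fraction \<open>t\<close> changes the objective by at most \<open>t\<close>
  times the excess plus a term of order \<open>t^2\<close>, and this change is nonnegative.\<close>

lemma excess_nonneg:
  assumes "h u < \<infinity>"
  shows "0 \<le> excess xb u"
proof (rule nonneg_if_quadratic_nonneg)
  fix t :: real assume t: "0 < t" "t < 1"
  obtain r where r: "h u = ereal r" using assms by (rule h_finite)
  define z where "z = (1 - t) *\<^sub>R xb + t *\<^sub>R u"
  have z: "z - xb = t *\<^sub>R (u - xb)" by (simp add: z_def algebra_simps)
  have "h z \<le> ereal ((1 - t) * (v - g xb) + t * r)"
    unfolding z_def using t h_minimizer r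
    by (intro closed_convex_convexD[OF closed_convex_h]) auto
  then have "objective g h z \<le> ereal (g z + (1 - t) * (v - g xb) + t * r)"
    by (simp add: objective_le_iff)
  moreover have "ereal v \<le> objective g h z"
    unfolding v[symmetric] by (rule INF_lower) simp
  ultimately have "v \<le> g z + (1 - t) * (v - g xb) + t * r"
    by (metis ereal_less_eq(3) order_trans)
  also have "g z \<le> g xb + t * (D xb \<bullet> (u - xb)) + L / 2 * (t\<^sup>2 * (norm (u - xb))\<^sup>2)"
    using upper[of z xb] by (simp add: z power_mult_distrib)
  finally show "0 \<le> t * excess xb u + t\<^sup>2 * (L / 2 * (norm (u - xb))\<^sup>2)"
    unfolding excess_def h_minimizer r by (simp add: algebra_simps)
qed

text \<open>Together with \<open>gap_le_of_excess\<close> this sandwiches the gap at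
  \<open>u\<close> between the excess plus the \<open>\<mu>\<close>-quadratic and the excess plus
  the \<open>L\<close>-quadratic around \<open>xb\<close>.\<close>

lemma gap_le_imp_excess:
  assumes "gap (objective g h) u \<le> ereal e"
  shows "h u < \<infinity>" "excess xb u + \<mu> / 2 * (norm (u - xb))\<^sup>2 \<le> e"
proof -
  have *: "h u \<le> ereal (v + e - g u)"
    using assms by (simp add: gap_le_iff[OF v] objective_le_iff)
  then show fin: "h u < \<infinity>" by (rule le_less_trans) simp
  then obtain r where "h u = ereal r" by (rule h_finite)
  with * have "real_of_ereal (h u) \<le> v + e - g u" by simp
  with lower[of xb u] show "excess xb u + \<mu> / 2 * (norm (u - xb))\<^sup>2 \<le> e"
    by (simp add: excess_def h_minimizer)
qed

lemma gap_le_of_excess: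
  assumes "h u < \<infinity>" "excess xb u + L / 2 * (norm (u - xb))\<^sup>2 \<le> e"
  shows "gap (objective g h) u \<le> ereal e"
proof -
  have "real_of_ereal (h u) \<le> v + e - g u"
    using upper[of u xb] assms(2) by (simp add: excess_def h_minimizer)
  moreover obtain r where "h u = ereal r" using assms(1) by (rule h_finite)
  ultimately show ?thesis
    unfolding gap_le_iff[OF v] objective_le_iff by simp
qed

end

end

section \<open>Median radii and majorities\<close>

text \<open>The entries below \<open>c\<close> form an initial segment of a sorted list, so an order
  statistic can be compared with \<open>c\<close> by counting.\<close>

lemma sorted_nth_less_iff:
  fixes c :: "'b::linorder"
  assumes "sorted xs" "n < length xs"
  shows "xs ! n < c \<longleftrightarrow> n < card {i. i < length xs \<and> xs ! i < c}"
proof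
  assume *: "xs ! n < c"
  have "{..n} \<subseteq> {i. i < length xs \<and> xs ! i < c}"
    using assms * by (auto intro: le_less_trans[OF sorted_nth_mono])
  then have "card {..n} \<le> card {i. i < length xs \<and> xs ! i < c}"
    by (intro card_mono) auto
  then show "n < card {i. i < length xs \<and> xs ! i < c}" by simp
next
  assume *: "n < card {i. i < length xs \<and> xs ! i < c}"
  show "xs ! n < c"
  proof (rule ccontr)
    assume "\<not> xs ! n < c"
    then have "{i. i < length xs \<and> xs ! i < c} \<subseteq> {..<n}"
      using assms by (auto simp: not_less intro: leI dest: sorted_nth_mono[of xs n])
    then have "card {i. i < length xs \<and> xs ! i < c} \<le> card {..<n}"
      by (intro card_mono) auto
    with * show False by simp
  qed
qed

lemma median_radius_less_iff:
  assumes "0 < m"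
  shows "median_radius m \<rho> y < c \<longleftrightarrow> m \<le> 2 * card {k. k < m \<and> majority_radius m \<rho> y k < c}"
proof -
  define r where "r = majority_radius m \<rho> y"
  define xs where "xs = sort (map r [0..<m])"
  have len: "length xs = m" by (simp add: xs_def)
  have "card {i. i < length xs \<and> xs ! i < c} = length (filter (\<lambda>x. x < c) xs)"
    by (rule length_filter_conv_card[symmetric])
  also have "\<dots> = size (filter_mset (\<lambda>x. x < c) (mset xs))"
    by (metis mset_filter size_mset)
  also have "mset xs = mset (map r [0..<m])" by (simp add: xs_def)
  also have "size (filter_mset (\<lambda>x. x < c) (mset (map r [0..<m]))) = length (filter (\<lambda>x. x < c) (map r [0..<m]))"
    by (metis mset_filter size_mset)
  also have "\<dots> = card {k. k < m \<and> r k < c}"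
    by (subst length_filter_conv_card) (auto intro!: arg_cong[where f = card])
  finally have card: "card {i. i < length xs \<and> xs ! i < c} = card {k. k < m \<and> r k < c}" .
  \<comment> \<open>The median is entry number ceil(m/2) counted from 1, hence has index
    \<open>(m + 1) div 2 - 1\<close>. More than that many entries lie below \<open>c\<close> exactly
    when at least half of them do.\<close>
  have n: "nat \<lceil>real m / 2\<rceil> = (m + 1) div 2"
    by linarith
  have "median_radius m \<rho> y = xs ! ((m + 1) div 2 - 1)"
    by (simp add: median_radius_def xs_def r_def n)
  also have "\<dots> < c \<longleftrightarrow> (m + 1) div 2 - 1 < card {k. k < m \<and> r k < c}"
    using sorted_nth_less_iff[of xs "(m + 1) div 2 - 1" c] assms unfolding len card[unfolded len]
    by (simp add: xs_def)
  also have "\<dots> \<longleftrightarrow> m \<le> 2 * card {k. k < m \<and> r k < c}"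
    using assms by linarith
  finally show ?thesis by (simp add: r_def)
qed

text \<open>Replaces sorting by counting: negate \<open>median_radius_less_iff\<close> at the radius
  of \<open>i\<close> itself.\<close>

lemma Extract_iff:
  "i \<in> Extract m \<rho> y \<longleftrightarrow>
    i < m \<and> 2 * card {k. k < m \<and> majority_radius m \<rho> y k < majority_radius m \<rho> y i} < m"
proof (cases "i < m")
  case True
  then show ?thesis
    using median_radius_less_iff[of m \<rho> y "majority_radius m \<rho> y i"]
    by (simp add: Extract_def flip: not_less)
qed (simp add: Extract_def)

text \<open>\<open>LEAST\<close> over the dense order \<open>ereal\<close> is informative only if
  the least element is attained. It is, since the defining condition can start to hold only at one
  of the finitely many values in \<open>F\<close>.\<close>

lemma majority_radius_le_iff:
  assumes "0 < m"
  shows "majority_radius m \<rho> y i \<le> R \<longleftrightarrow> 0 \<le> R \<and> m < 2 * card {k. k < m \<and> \<rho> (y i) (y k) \<le> R}"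
proof -
  define P where "P r \<longleftrightarrow> 0 \<le> r \<and> m < 2 * card {k. k < m \<and> \<rho> (y i) (y k) \<le> r}" for r
  define F where "F = insert 0 ((\<lambda>k. \<rho> (y i) (y k)) ` {..<m})"
  have P_mono: "P s" if "P r" "r \<le> s" for r s
  proof -
    have "card {k. k < m \<and> \<rho> (y i) (y k) \<le> r} \<le> card {k. k < m \<and> \<rho> (y i) (y k) \<le> s}"
      using that by (intro card_mono) auto
    then show ?thesis using that by (auto simp: P_def)
  qed
  \<comment> \<open>An admissible radius can be lowered to the largest element of \<open>F\<close>
    below it without losing a point; 0 belongs to \<open>F\<close> so that such an element always
    exists.\<close>
  have P_F: "\<exists>s\<in>F. P s \<and> s \<le> r" if "P r" for r
  proof -
    define s where "s = Max {q \<in> F. q \<le> r}"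
    have fin: "finite {q \<in> F. q \<le> r}" and ne: "{q \<in> F. q \<le> r} \<noteq> {}"
      using that by (auto simp: F_def P_def)
    have s: "s \<in> F" "s \<le> r" using Max_in[OF fin ne] by (auto simp: s_def)
    have "q \<le> s" if "q \<in> F" "q \<le> r" for q
      unfolding s_def using that fin by (intro Max_ge) auto
    then have "{k. k < m \<and> \<rho> (y i) (y k) \<le> s} = {k. k < m \<and> \<rho> (y i) (y k) \<le> r}" "0 \<le> s"
      using s that by (auto simp: F_def P_def)
    with that have "P s" by (simp add: P_def)
    with s show ?thesis by blast
  qed
  have "P \<infinity>" using assms by (simp add: P_def)
  define r where "r = Min {q \<in> F. P q}"
  have fin: "finite {q \<in> F. P q}" and ne: "{q \<in> F. P q} \<noteq> {}"
    using P_F[OF \<open>P \<infinity>\<close>] by (auto simp: F_def)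
  have r: "P r" using Min_in[OF fin ne] by (auto simp: r_def)
  have r_le: "r \<le> q" if "P q" for q
  proof -
    from P_F[OF that] obtain s where s: "s \<in> F" "P s" "s \<le> q" by blast
    then have "r \<le> s" unfolding r_def by (intro Min_le fin) simp
    with s(3) show ?thesis by simp
  qed
  have "majority_radius m \<rho> y i = (LEAST r. P r)"
    unfolding majority_radius_def P_def
    by (rule arg_cong[where f = Least]) (auto simp: fun_eq_iff)
  also have "\<dots> = r"
    using r r_le by (rule Least_equality)
  finally have "majority_radius m \<rho> y i \<le> R \<longleftrightarrow> P R"
    using r r_le[of R] P_mono[of r R] by auto
  then show ?thesis by (simp add: P_def)
qed

text \<open>Pigeonhole. Only one of the two majorities has to be strict; \<open>card_Extract\<close>
  supplies just a weak one.\<close>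

lemma majority_sets_intersect:
  assumes "m < 2 * card {k. k < m \<and> A k}" "m \<le> 2 * card {k. k < m \<and> B k}"
  shows "\<exists>k<m. A k \<and> B k"
proof (rule ccontr)
  assume *: "\<not> (\<exists>k<m. A k \<and> B k)"
  have "card {k. k < m \<and> A k} + card {k. k < m \<and> B k} = card ({k. k < m \<and> A k} \<union> {k. k < m \<and> B k})"
    using * by (intro card_Un_disjoint[symmetric]) auto
  also have "\<dots> \<le> card {..<m}" by (intro card_mono) auto
  finally show False using assms by simp
qed

text \<open>Each good point has radius at most \<open>R\<close>, as its ball contains all good
  points. If \<open>i\<close> had a larger radius, more than half of the indices would beat it and
  \<open>Extract\<close> would have dropped it. So the \<open>R\<close>-ball of \<open>i\<close>
  holds a majority and meets the good one.\<close>

lemma Extract_near_majority: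
  assumes i: "i \<in> Extract m \<rho> y" and maj: "m < 2 * card {k. k < m \<and> A k}"
    and "0 \<le> R" and R: "\<And>k l. k < m \<Longrightarrow> A k \<Longrightarrow> l < m \<Longrightarrow> A l \<Longrightarrow> \<rho> (y k) (y l) \<le> R"
  shows "\<exists>k<m. A k \<and> \<rho> (y i) (y k) \<le> R"
proof -
  have m: "i < m" "0 < m" using i by (auto simp: Extract_def)
  have rad: "majority_radius m \<rho> y k \<le> R" if "k < m" "A k" for k
  proof -
    have "card {l. l < m \<and> A l} \<le> card {l. l < m \<and> \<rho> (y k) (y l) \<le> R}"
      using R that by (intro card_mono) auto
    then show ?thesis
      using m maj \<open>0 \<le> R\<close> by (simp add: majority_radius_le_iff)
  qed
  have "majority_radius m \<rho> y i \<le> R"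
  proof (rule ccontr)
    assume "\<not> majority_radius m \<rho> y i \<le> R"
    then have "{k. k < m \<and> A k} \<subseteq> {k. k < m \<and> majority_radius m \<rho> y k < majority_radius m \<rho> y i}"
      using rad by force
    then have "card {k. k < m \<and> A k} \<le> card {k. k < m \<and> majority_radius m \<rho> y k < majority_radius m \<rho> y i}"
      by (intro card_mono) auto
    with maj i show False by (auto simp: Extract_iff)
  qed
  then show ?thesis
    using m maj majority_sets_intersect[OF maj, of "\<lambda>k. \<rho> (y i) (y k) \<le> R"]
    by (simp add: majority_radius_le_iff)
qed

lemma center_set_eq:
  "center_set m v = {k. k < m \<and> (\<forall>l<m. majority_radius m rho_norm v k \<le> majority_radius m rho_norm v l)}"
  unfolding center_set_def is_arg_min_def by (auto simp flip: not_le)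

lemma center_set_nonempty:
  assumes "0 < m"
  shows "center_set m v \<noteq> {}"
proof -
  define r where "r = majority_radius m rho_norm v"
  have fin: "finite (r ` {..<m})" and "r ` {..<m} \<noteq> {}"
    using assms by auto
  then have "Min (r ` {..<m}) \<in> r ` {..<m}" by (rule Min_in)
  then obtain k where "k < m" "r k = Min (r ` {..<m})" by auto
  with fin have "k \<in> center_set m v"
    unfolding center_set_eq r_def[symmetric] by auto
  then show ?thesis by blast
qed

text \<open>A good index exists and has radius at most \<open>R\<close>; the minimizer
  \<open>k\<close> does no worse, so its ball meets the good majority.\<close>

lemma center_near_majority:
  assumes k: "k \<in> center_set m v" and maj: "m < 2 * card {k. k < m \<and> A k}"
    and "0 \<le> R" and R: "\<And>k l. k < m \<Longrightarrow> A k \<Longrightarrow> l < m \<Longrightarrow> A l \<Longrightarrow> norm (v k - v l) \<le> R"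
  shows "\<exists>l<m. A l \<and> norm (v k - v l) \<le> R"
proof -
  have m: "k < m" "0 < m" using k by (auto simp: center_set_eq)
  have "{k. k < m \<and> A k} \<noteq> {}" using maj by (metis card.empty mult_0_right not_less0)
  then obtain l where l: "l < m" "A l" by auto
  have "card {j. j < m \<and> A j} \<le> card {j. j < m \<and> rho_norm (v l) (v j) \<le> ereal R}"
    using R l by (intro card_mono) (auto simp: rho_norm_def)
  then have "majority_radius m rho_norm v l \<le> ereal R"
    using m maj \<open>0 \<le> R\<close> by (simp add: majority_radius_le_iff)
  with k l have "majority_radius m rho_norm v k \<le> ereal R"
    by (auto simp: center_set_eq intro: order_trans)
  then show ?thesis
    using m maj majority_sets_intersect[OF maj, of "\<lambda>l. rho_norm (v k) (v l) \<le> ereal R"]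
    by (simp add: majority_radius_le_iff rho_norm_def)
qed

text \<open>Among the dropped indices take one of smallest radius. At least half of all indices have
  a strictly smaller radius than it, and by minimality none of those was dropped.\<close>

lemma card_Extract:
  assumes "0 < m"
  shows "m \<le> 2 * card (Extract m \<rho> y)"
proof (cases "Extract m \<rho> y = {..<m}")
  case False
  define r where "r = majority_radius m \<rho> y"
  have "Extract m \<rho> y \<subseteq> {..<m}" by (auto simp: Extract_def)
  with False have "{..<m} - Extract m \<rho> y \<noteq> {}" by blast
  then obtain i where i: "i \<in> {..<m} - Extract m \<rho> y" "\<And>k. k \<in> {..<m} - Extract m \<rho> y \<Longrightarrow> r i \<le> r k"
    using ex_min_if_finite[of "r ` ({..<m} - Extract m \<rho> y)"] by (force simp: not_less)
  have "m \<le> 2 * card {k. k < m \<and> r k < r i}"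
    using i(1) by (auto simp: Extract_iff r_def)
  also have "\<dots> \<le> 2 * card (Extract m \<rho> y)"
    using i(2) by (intro mult_le_mono2 card_mono) (force simp: Extract_def)+
  finally show ?thesis .
qed simp

lemma Extract_nonempty:
  assumes "0 < m"
  shows "Extract m \<rho> y \<noteq> {}"
  using card_Extract[OF assms, of \<rho> y] assms by auto

text \<open>For odd \<open>m\<close>, at least half means more than half. This is why a run with odd
  \<open>m\<close> always has an index to return.\<close>

lemma Extract_intersect_odd:
  assumes "odd m"
  shows "Extract m \<rho> y \<inter> Extract m \<rho>' y' \<noteq> {}"
proof -
  have "0 < m" using assms by (rule odd_pos)
  have eq: "{k. k < m \<and> k \<in> Extract m \<rho> y} = Extract m \<rho> y" for \<rho> and y :: "nat \<Rightarrow> 'c"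
    by (auto simp: Extract_def)
  have "m < 2 * card (Extract m \<rho> y)"
    using card_Extract[OF \<open>0 < m\<close>, of \<rho> y] assms by (metis dvd_triv_left order_le_imp_less_or_eq)
  then show ?thesis
    using majority_sets_intersect[of m "\<lambda>k. k \<in> Extract m \<rho> y" "\<lambda>k. k \<in> Extract m \<rho>' y'"]
      card_Extract[OF \<open>0 < m\<close>, of \<rho>' y'] unfolding eq by auto
qed

section \<open>The deterministic bound for robust gap estimation\<close>

context composite
begin

context
  fixes v e :: real and xb :: 'a and m :: nat and u :: "nat \<Rightarrow> 'a"
  assumes v: "(INF y. objective g h y) = ereal v" and xb: "objective g h xb = ereal v"
    and maj: "m < 2 * card {k. k < m \<and> gap (objective g h) (u k) \<le> ereal e}"
begin

lemma accuracy_nonneg: "0 \<le> e"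
proof -
  obtain k where "gap (objective g h) (u k) \<le> ereal e"
    using maj by (metis (no_types, lifting) Collect_empty_eq card.empty mult_0_right not_less0)
  from gap_le_imp_excess[OF v xb this] excess_nonneg[OF v xb]
  have "\<mu> / 2 * (norm (u k - xb))\<^sup>2 \<le> e" by (smt (verit))
  then show ?thesis using mu_pos by (smt (verit) mult_nonneg_nonneg divide_nonneg_nonneg zero_le_power2)
qed

lemma near_minimizer:
  assumes "gap (objective g h) x \<le> ereal e"
  shows "norm (x - xb) \<le> sqrt (2 * e / \<mu>)"
proof -
  have "\<mu> / 2 * (norm (x - xb))\<^sup>2 \<le> e"
    using gap_le_imp_excess[OF v xb assms] excess_nonneg[OF v xb] by (smt (verit))
  then show ?thesis
    using mu_pos by (intro real_le_rsqrt) (simp add: field_simps)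
qed

text \<open>Good candidates are within \<open>r = sqrt (2 * e / \<mu>)\<close> of \<open>xb\<close>,
  hence within \<open>2 * r\<close> of each other; a surviving index is within \<open>2 * r\<close>
  of some good one.\<close>

lemma candidate_near_minimizer:
  assumes "i \<in> Extract m rho_norm u"
  shows "norm (u i - xb) \<le> 3 * sqrt (2 * e / \<mu>)"
proof -
  let ?r = "sqrt (2 * e / \<mu>)"
  have "\<exists>k<m. gap (objective g h) (u k) \<le> ereal e \<and> rho_norm (u i) (u k) \<le> ereal (2 * ?r)"
  proof (rule Extract_near_majority[OF assms maj])
    show "0 \<le> ereal (2 * ?r)" using accuracy_nonneg mu_pos by simp
    fix k l assume "gap (objective g h) (u k) \<le> ereal e" "gap (objective g h) (u l) \<le> ereal e"
    then have "norm (u k - xb) \<le> ?r" "norm (u l - xb) \<le> ?r"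
      by (auto intro: near_minimizer)
    then show "rho_norm (u k) (u l) \<le> ereal (2 * ?r)"
      using norm_triangle_ineq4[of "u k - xb" "u l - xb"] by (simp add: rho_norm_def)
  qed
  then obtain k where "norm (u k - xb) \<le> ?r" "norm (u i - u k) \<le> 2 * ?r"
    using near_minimizer by (auto simp: rho_norm_def)
  then show ?thesis
    using norm_triangle_ineq[of "u i - u k" "u k - xb"] by simp
qed

lemma robust_gap_bound:
  assumes i: "i \<in> Extract m rho_norm u"
    and l: "l \<in> Extract m rho_norm u" "l \<in> Extract m (rho_grad h w) u"
    and w: "norm (w - D (u i)) \<le> 3 * (L / \<mu> * sqrt (\<mu> * e))"
  shows "gap (objective g h) (u l) \<le> ereal (74 * (L / \<mu>) * e)"
proof -
  define r where "r = sqrt (2 * e / \<mu>)"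
  define W where "W = norm (w - D xb)"
  define R where "R = e + W * r"
  have r: "0 \<le> r" "r\<^sup>2 = 2 * e / \<mu>" and W: "0 \<le> W"
    using accuracy_nonneg mu_pos by (simp_all add: r_def W_def)
  have lin: "\<bar>(w - D xb) \<bullet> (x - xb)\<bar> \<le> W * s" if "norm (x - xb) \<le> s" for x s
    using Cauchy_Schwarz_ineq2[of "w - D xb" "x - xb"] mult_left_mono[OF that W] by (simp add: W_def)
  \<comment> \<open>The second pseudometric compares excesses perturbed by the gradient error
    \<open>w - D xb\<close>; all terms depending on \<open>xb\<close> alone cancel in the
    difference.\<close>
  have rho: "rho_grad h w x x' = ereal \<bar>(excess xb x + (w - D xb) \<bullet> (x - xb)) -
      (excess xb x' + (w - D xb) \<bullet> (x' - xb))\<bar>" if "h x < \<infinity>" "h x' < \<infinity>" for x x'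
    using that unfolding rho_grad_def excess_def
    by (simp add: inner_diff_left inner_diff_right algebra_simps)
  have good: "h x < \<infinity>" "\<bar>excess xb x + (w - D xb) \<bullet> (x - xb)\<bar> \<le> R"
    if "gap (objective g h) x \<le> ereal e" for x
  proof -
    note ex = gap_le_imp_excess[OF v xb that]
    show "h x < \<infinity>" by (rule ex)
    have "0 \<le> \<mu> / 2 * (norm (x - xb))\<^sup>2" using mu_pos by simp
    with ex(2) excess_nonneg[OF v xb ex(1)] lin[OF near_minimizer[OF that]]
    show "\<bar>excess xb x + (w - D xb) \<bullet> (x - xb)\<bar> \<le> R"
      unfolding R_def r_def by (smt (verit))
  qed
  have R: "0 \<le> R" using r W accuracy_nonneg by (simp add: R_def)
  have "\<exists>k<m. gap (objective g h) (u k) \<le> ereal e \<and> rho_grad h w (u l) (u k) \<le> ereal (2 * R)"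
  proof (rule Extract_near_majority[OF l(2) maj])
    fix j k assume "gap (objective g h) (u j) \<le> ereal e" "gap (objective g h) (u k) \<le> ereal e"
    note good[OF this(1)] good[OF this(2)]
    then show "rho_grad h w (u j) (u k) \<le> ereal (2 * R)"
      by (simp add: rho)
  qed (use R in simp)
  then obtain k where k: "gap (objective g h) (u k) \<le> ereal e" "rho_grad h w (u l) (u k) \<le> ereal (2 * R)"
    by blast
  have hl: "h (u l) < \<infinity>" using k(2) by (auto simp: rho_grad_def split: if_splits)
  have near: "norm (u l - xb) \<le> 3 * r" "norm (u i - xb) \<le> 3 * r"
    using candidate_near_minimizer l(1) i by (simp_all add: r_def)
  \<comment> \<open>\<open>2 * R\<close> comes from the pseudometric, \<open>R\<close> from the
    perturbed excess of the good point, and \<open>W * (3 * r)\<close> from removing the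
    perturbation at the output.\<close>
  have ex: "excess xb (u l) \<le> 3 * R + W * (3 * r)"
    using k(2) good[OF k(1)] lin[OF near(1)] unfolding rho[OF hl good(1)[OF k(1)]]
    by (simp add: abs_le_iff)
  have smooth: "L / 2 * (norm (u l - xb))\<^sup>2 \<le> 9 * (L / \<mu>) * e"
  proof -
    have "(norm (u l - xb))\<^sup>2 \<le> (3 * r)\<^sup>2" using near by (intro power_mono) auto
    also have "\<dots> = 18 * e / \<mu>" using r by (simp add: power_mult_distrib)
    finally have "L / 2 * (norm (u l - xb))\<^sup>2 \<le> L / 2 * (18 * e / \<mu>)"
      using L_pos by (intro mult_left_mono) auto
    then show ?thesis by simp
  qed
  \<comment> \<open>The error \<open>W\<close> splits at \<open>u i\<close>: the estimate is taken
    there, and the gradient varies by at most \<open>L * (3 * r)\<close> between \<open>u i\<close>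
    and \<open>xb\<close>. The products with \<open>r\<close> simplify to multiples of
    \<open>e\<close>.\<close>
  have Wr: "W * r \<le> 3 * (L / \<mu>) * (sqrt 2 + 2) * e"
  proof -
    have "W \<le> norm (w - D (u i)) + norm (D (u i) - D xb)"
      using norm_triangle_ineq[of "w - D (u i)" "D (u i) - D xb"] by (simp add: W_def)
    also have "\<dots> \<le> 3 * (L / \<mu> * sqrt (\<mu> * e)) + L * (3 * r)"
      using w lipschitz[of "u i" xb] mult_left_mono[OF near(2), of L] L_pos by linarith
    finally have "W * r \<le> (3 * (L / \<mu> * sqrt (\<mu> * e)) + L * (3 * r)) * r"
      using r by (intro mult_right_mono)
    also have "\<dots> = 3 * (L / \<mu>) * (sqrt (\<mu> * e) * r) + 3 * L * r\<^sup>2"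
      by (simp add: algebra_simps power2_eq_square)
    also have "sqrt (\<mu> * e) * r = sqrt 2 * e"
      using mu_pos accuracy_nonneg unfolding r_def
      by (simp add: real_sqrt_mult[symmetric]) (simp add: real_sqrt_mult)
    finally show ?thesis using r by (simp add: algebra_simps)
  qed
  have e: "e \<le> (L / \<mu>) * e"
    using mu_le_L mu_pos accuracy_nonneg by (simp add: field_simps mult_right_mono)
  have sqrt2: "(L / \<mu>) * (sqrt 2 * e) \<le> (L / \<mu>) * (283 / 200 * e)"
  proof (intro mult_left_mono mult_right_mono accuracy_nonneg)
    show "sqrt 2 \<le> 283 / 200" by (rule real_le_lsqrt) (auto simp: power2_eq_square)
  qed (use L_pos mu_pos in simp)
  define K where "K = L / \<mu> * e"
  define s where "s = L / \<mu> * (sqrt 2 * e)"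
  have eqs: "3 * (L / \<mu>) * (sqrt 2 + 2) * e = 3 * s + 6 * K" "9 * (L / \<mu>) * e = 9 * K"
    "(L / \<mu>) * (283 / 200 * e) = 283 / 200 * K" "74 * (L / \<mu>) * e = 74 * K" "W * (3 * r) = 3 * (W * r)"
    by (simp_all add: K_def s_def algebra_simps)
  have K: "0 \<le> K" using L_pos mu_pos accuracy_nonneg by (simp add: K_def)
  \<comment> \<open>In units of \<open>K\<close>, with \<open>sqrt 2\<close> replaced by 1.415, the
    total is 3 + 6 (3 * 1.415 + 6) + 9 = 73.47, which is rounded up to 74.\<close>
  have "x + n \<le> 74 * K" if "x \<le> 3 * (e + y) + 3 * y" "n \<le> 9 * K" "y \<le> 3 * s + 6 * K"
    "e \<le> K" "s \<le> 283 / 200 * K" for x n y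
    using that K by argo
  then have "excess xb (u l) + L / 2 * (norm (u l - xb))\<^sup>2 \<le> 74 * (L / \<mu>) * e"
    using ex smooth Wr e sqrt2 unfolding R_def eqs K_def[symmetric] s_def[symmetric] by blast
  then show ?thesis by (rule gap_le_of_excess[OF v xb hl])
qed

end

end

lemma center_near_target:
  fixes v :: "nat \<Rightarrow> 'a::real_normed_vector"
  assumes "m < 2 * card {k. k < m \<and> norm (v k - d) \<le> a}" "k \<in> center_set m v" "0 \<le> a"
  shows "norm (v k - d) \<le> 3 * a"
proof -
  have "\<exists>l<m. norm (v l - d) \<le> a \<and> norm (v k - v l) \<le> 2 * a"
  proof (rule center_near_majority[OF assms(2,1)])
    fix i j assume "norm (v i - d) \<le> a" "norm (v j - d) \<le> a"
    then show "norm (v i - v j) \<le> 2 * a"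
      using norm_triangle_ineq4[of "v i - d" "v j - d"] by simp
  qed (use assms in simp)
  then obtain l where "norm (v l - d) \<le> a" "norm (v k - v l) \<le> 2 * a" by blast
  then show ?thesis using norm_triangle_ineq[of "v k - v l" "v l - d"] by simp
qed

section \<open>Concentration\<close>

text \<open>Union bound for two successive random steps: the kernel is bounded by 1 on the bad set
  \<open>A\<close> and by \<open>b\<close> off it. Subprobabilities are allowed because a run may
  lose mass.\<close>

lemma emeasure_bind_le_bad_set:
  assumes M: "M \<in> space (subprob_algebra N)" and K: "K \<in> N \<rightarrow>\<^sub>M subprob_algebra R"
    and "X \<in> sets R" "A \<in> sets N" "emeasure M A \<le> a"
    and good: "\<And>x. x \<in> space N \<Longrightarrow> x \<notin> A \<Longrightarrow> emeasure (K x) X \<le> b"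
  shows "emeasure (bind M K) X \<le> a + b"
proof -
  have sets: "sets M = sets N" and sub: "subprob_space M" using M by (auto simp: space_subprob_algebra)
  have space: "space M = space N" using sets by (rule sets_eq_imp_space_eq)
  have ne: "space M \<noteq> {}" using sub by (rule subprob_space.subprob_not_empty)
  have K': "K \<in> M \<rightarrow>\<^sub>M subprob_algebra R" using K by (simp cong: measurable_cong_sets add: sets)
  have "emeasure (bind M K) X = (\<integral>\<^sup>+x. emeasure (K x) X \<partial>M)"
    by (rule emeasure_bind[OF ne K' assms(3)])
  also have "\<dots> \<le> (\<integral>\<^sup>+x. indicator A x + b \<partial>M)"
  proof (rule nn_integral_mono)
    fix x assume "x \<in> space M"
    then have "subprob_space (K x)" using measurable_space[OF K'] by (auto simp: space_subprob_algebra)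
    then have "emeasure (K x) X \<le> 1" by (rule subprob_space.subprob_emeasure_le_1)
    then show "emeasure (K x) X \<le> indicator A x + b"
      using good \<open>x \<in> space M\<close> space by (cases "x \<in> A") (auto intro: order_trans add_increasing2)
  qed
  also have "\<dots> = emeasure M A + b * emeasure M (space M)"
    using assms(4) sets by (subst nn_integral_add) auto
  also have "\<dots> \<le> a + b * 1"
    using assms(5) subprob_space.emeasure_space_le_1[OF sub] by (intro add_mono mult_left_mono) auto
  finally show ?thesis by simp
qed

text \<open>The coordinates are independent because their joint law is the product measure itself;
  the empty index set is separate because that characterization requires a nonempty one.\<close>

lemma indep_vars_PiM_components:
  assumes "prob_space M" "finite I" "\<And>i. i \<in> I \<Longrightarrow> f i \<in> M \<rightarrow>\<^sub>M N"
  shows "prob_space.indep_vars (PiM I (\<lambda>_. M)) (\<lambda>_. N) (\<lambda>i \<omega>. f i (\<omega> i)) I"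
proof (cases "I = {}")
  case True
  interpret M: prob_space M by fact
  interpret P: prob_space "PiM I (\<lambda>_. M)" by (rule prob_space_PiM) (rule M.prob_space_axioms)
  show ?thesis
    unfolding P.indep_vars_def P.indep_sets_def unfolding True by simp
next
  case False
  interpret M: prob_space M by fact
  interpret P: prob_space "PiM I (\<lambda>_. M)" by (rule prob_space_PiM) (rule M.prob_space_axioms)
  interpret prod: product_prob_space "\<lambda>_. M" I by unfold_locales
  have "P.indep_vars (\<lambda>_. M) (\<lambda>i \<omega>. \<omega> i) I"
  proof (subst P.indep_vars_iff_distr_eq_PiM'[OF False])
    have "distr (PiM I (\<lambda>_. M)) (PiM I (\<lambda>_. M)) (\<lambda>x. \<lambda>i\<in>I. x i) = distr (PiM I (\<lambda>_. M)) (PiM I (\<lambda>_. M)) (\<lambda>x. x)"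
      by (rule distr_cong) (auto simp: space_PiM PiE_def extensional_restrict)
    also have "\<dots> = PiM I (\<lambda>_. M)" by simp
    also have "\<dots> = PiM I (\<lambda>i. distr (PiM I (\<lambda>_. M)) M (\<lambda>\<omega>. \<omega> i))"
      by (rule PiM_cong) (auto simp: prod.PiM_component)
    finally show "distr (PiM I (\<lambda>_. M)) (PiM I (\<lambda>_. M)) (\<lambda>x. \<lambda>i\<in>I. x i) = PiM I (\<lambda>i. distr (PiM I (\<lambda>_. M)) M (\<lambda>\<omega>. \<omega> i))" .
  qed auto
  from P.indep_vars_compose2[OF this, of f "\<lambda>_. N"] assms show ?thesis by auto
qed

text \<open>Hoeffding's inequality with deviation \<open>m / 6\<close>, the difference between the
  expected share 2/3 and the share 1/2; the exponent is 2 (m/6)^2 / m = m/18. For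
  \<open>m = 0\<close> the bound is 1.\<close>

lemma prob_no_majority_le:
  assumes "prob_space M" "A \<in> sets M" "2 / 3 \<le> measure M A"
  shows "measure (PiM {..<m} (\<lambda>_. M)) {\<omega> \<in> space (PiM {..<m} (\<lambda>_. M)). 2 * card {k. k < m \<and> \<omega> k \<in> A} \<le> m}
    \<le> exp (- (real m / 18))"
proof (cases "m = 0")
  case False
  interpret M: prob_space M by fact
  let ?P = "PiM {..<m} (\<lambda>_. M)"
  interpret P: prob_space ?P by (rule prob_space_PiM) (rule M.prob_space_axioms)
  interpret prod: product_prob_space "\<lambda>_. M" "{..<m}" by unfold_locales
  define X :: "nat \<Rightarrow> _ \<Rightarrow> real" where "X i \<omega> = indicator A (\<omega> i)" for i \<omega>
  interpret Hoeffding_ineq ?P "{..<m}" X "\<lambda>_. 0" "\<lambda>_. 1" "\<Sum>i<m. P.expectation (X i)"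
  proof unfold_locales
    show "P.indep_vars (\<lambda>_. borel) X {..<m}"
      unfolding X_def using assms by (intro indep_vars_PiM_components) auto
  qed (auto simp: X_def indicator_def)
  have E: "P.expectation (X i) = measure M A" if "i < m" for i
  proof -
    have "measure M A = (\<integral>x. indicator A x \<partial>distr ?P M (\<lambda>\<omega>. \<omega> i))"
      using that assms by (subst prod.PiM_component) auto
    also have "\<dots> = P.expectation (X i)"
      unfolding X_def using that assms by (subst integral_distr) auto
    finally show ?thesis by simp
  qed
  have sum: "(\<Sum>i<m. X i \<omega>) = real (card {k. k < m \<and> \<omega> k \<in> A})" for \<omega>
  proof -
    have "(\<Sum>i<m. X i \<omega>) = (\<Sum>i\<in>{k. k < m \<and> \<omega> k \<in> A}. 1)"
      by (rule sum.mono_neutral_cong_right) (auto simp: X_def)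
    then show ?thesis by simp
  qed
  have "{\<omega> \<in> space ?P. 2 * card {k. k < m \<and> \<omega> k \<in> A} \<le> m} \<subseteq>
      {\<omega> \<in> space ?P. (\<Sum>i<m. X i \<omega>) \<le> (\<Sum>i<m. P.expectation (X i)) - real m / 6}"
  proof safe
    fix \<omega> assume "2 * card {k. k < m \<and> \<omega> k \<in> A} \<le> m"
    then have "2 * real (card {k. k < m \<and> \<omega> k \<in> A}) \<le> real m" by linarith
    moreover have "(\<Sum>i<m. P.expectation (X i)) = real m * measure M A" using E by simp
    moreover have "real m * (2 / 3) \<le> real m * measure M A" using assms by (intro mult_left_mono) auto
    ultimately show "(\<Sum>i<m. X i \<omega>) \<le> (\<Sum>i<m. P.expectation (X i)) - real m / 6"
      unfolding sum by linarith
  qed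
  then have "measure ?P {\<omega> \<in> space ?P. 2 * card {k. k < m \<and> \<omega> k \<in> A} \<le> m} \<le>
      P.prob {\<omega> \<in> space ?P. (\<Sum>i<m. X i \<omega>) \<le> (\<Sum>i<m. P.expectation (X i)) - real m / 6}"
    using random_variable by (intro P.finite_measure_mono) auto
  also have "\<dots> \<le> exp (- 2 * (real m / 6)\<^sup>2 / (\<Sum>i<m. (1 - 0)\<^sup>2))"
    using False by (intro Hoeffding_ineq_le) auto
  also have "- 2 * (real m / 6)\<^sup>2 / (\<Sum>i<m. (1 - 0)\<^sup>2) = - (real m / 18)"
    using False by (simp add: power2_eq_square)
  finally show ?thesis .
qed (auto simp: PiM_empty measure_count_space)

text \<open>Expanding the square, independence and zero mean remove all mixed terms.\<close>

lemma sum_square_expectation_PiM: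
  fixes f :: "'z \<Rightarrow> real"
  assumes P: "prob_space P" and f[measurable]: "f \<in> borel_measurable P" and f2: "integrable P (\<lambda>z. (f z)\<^sup>2)"
    and f0: "integrable P f" "(\<integral>z. f z \<partial>P) = 0"
  shows "integrable (PiM {..<N} (\<lambda>_. P)) (\<lambda>\<omega>. (\<Sum>n<N. f (\<omega> n))\<^sup>2)"
    and "(\<integral>\<omega>. (\<Sum>n<N. f (\<omega> n))\<^sup>2 \<partial>PiM {..<N} (\<lambda>_. P)) = real N * (\<integral>z. (f z)\<^sup>2 \<partial>P)"
proof -
  let ?Q = "PiM {..<N} (\<lambda>_. P)"
  interpret P: prob_space P by fact
  interpret Q: prob_space ?Q by (rule prob_space_PiM) (rule P.prob_space_axioms)
  interpret prod: product_prob_space "\<lambda>_. P" "{..<N}" by unfold_locales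
  have comp: "integrable ?Q (\<lambda>\<omega>. \<phi> (\<omega> n))" "(\<integral>\<omega>. \<phi> (\<omega> n) \<partial>?Q) = (\<integral>z. \<phi> z \<partial>P)"
    if "n < N" "integrable P \<phi>" for n and \<phi> :: "'z \<Rightarrow> real"
  proof -
    have eq: "distr ?Q P (\<lambda>\<omega>. \<omega> n) = P" using that by (intro prod.PiM_component) auto
    have m: "(\<lambda>\<omega>. \<omega> n) \<in> ?Q \<rightarrow>\<^sub>M P" using that by simp
    show "integrable ?Q (\<lambda>\<omega>. \<phi> (\<omega> n))"
      using integrable_distr[OF m, of \<phi>] that(2) unfolding eq by simp
    show "(\<integral>\<omega>. \<phi> (\<omega> n) \<partial>?Q) = (\<integral>z. \<phi> z \<partial>P)"
      using integral_distr[OF m borel_measurable_integrable[OF that(2)]] unfolding eq by simp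
  qed
  have cross: "integrable ?Q (\<lambda>\<omega>. f (\<omega> n) * f (\<omega> k)) \<and>
      (\<integral>\<omega>. f (\<omega> n) * f (\<omega> k) \<partial>?Q) = (if n = k then \<integral>z. (f z)\<^sup>2 \<partial>P else 0)" if nk: "n < N" "k < N" for n k
  proof (cases "n = k")
    case True
    then show ?thesis using comp[OF nk(1) f2] by (simp add: power2_eq_square)
  next
    case False
    have ind: "Q.indep_vars (\<lambda>_. borel) (\<lambda>i \<omega>. f (\<omega> i)) {n, k}"
      using nk by (intro Q.indep_vars_subset[OF indep_vars_PiM_components[OF P]]) auto
    have int: "integrable ?Q (\<lambda>\<omega>. f (\<omega> i))" if "i \<in> {n, k}" for i
      using that nk comp(1)[OF _ f0(1)] by auto
    have "(\<lambda>\<omega>. f (\<omega> n) * f (\<omega> k)) = (\<lambda>\<omega>. \<Prod>i\<in>{n, k}. f (\<omega> i))"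
      using False by simp
    then show ?thesis
      using Q.indep_vars_integrable[OF _ ind int] Q.indep_vars_lebesgue_integral[OF _ ind int]
        False comp(2)[OF nk(1) f0(1)] f0(2) by simp
  qed
  have sq: "(\<Sum>n<N. f (\<omega> n))\<^sup>2 = (\<Sum>n<N. \<Sum>k<N. f (\<omega> n) * f (\<omega> k))" for \<omega>
    by (simp add: power2_eq_square sum_product)
  show "integrable ?Q (\<lambda>\<omega>. (\<Sum>n<N. f (\<omega> n))\<^sup>2)"
    unfolding sq using cross by (intro Bochner_Integration.integrable_sum) auto
  have "(\<integral>\<omega>. (\<Sum>n<N. f (\<omega> n))\<^sup>2 \<partial>?Q) = (\<Sum>n<N. \<Sum>k<N. \<integral>\<omega>. f (\<omega> n) * f (\<omega> k) \<partial>?Q)"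
    unfolding sq using cross by (subst Bochner_Integration.integral_sum; (intro Bochner_Integration.integrable_sum sum.cong refl Bochner_Integration.integral_sum)?) auto
  also have "\<dots> = (\<Sum>n<N. \<Sum>k<N. if n = k then \<integral>z. (f z)\<^sup>2 \<partial>P else 0)"
    using cross by (intro sum.cong refl) auto
  also have "\<dots> = real N * (\<integral>z. (f z)\<^sup>2 \<partial>P)" by simp
  finally show "(\<integral>\<omega>. (\<Sum>n<N. f (\<omega> n))\<^sup>2 \<partial>?Q) = real N * (\<integral>z. (f z)\<^sup>2 \<partial>P)" .
qed

text \<open>Chebyshev's inequality for vectors: second moments are computed coordinate by coordinate
  and summed over the basis.\<close>

lemma sample_average_concentration:
  fixes Y :: "'z \<Rightarrow> 'a::euclidean_space"
  assumes P: "prob_space P" and Y0: "integrable P Y" "(\<integral>z. Y z \<partial>P) = 0"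
    and Y2: "(\<integral>\<^sup>+z. ennreal ((norm (Y z))\<^sup>2) \<partial>P) \<le> ennreal s" "0 \<le> s"
    and N: "0 < N" and a: "0 < a" "3 * s \<le> real N * a\<^sup>2"
  shows "2 / 3 \<le> measure (PiM {..<N} (\<lambda>_. P))
    {\<omega> \<in> space (PiM {..<N} (\<lambda>_. P)). norm ((\<Sum>n<N. Y (\<omega> n)) /\<^sub>R real N) \<le> a}"
proof -
  let ?Q = "PiM {..<N} (\<lambda>_. P)"
  interpret P: prob_space P by fact
  interpret Q: prob_space ?Q by (rule prob_space_PiM) (rule P.prob_space_axioms)
  have [measurable]: "Y \<in> borel_measurable P" using Y0(1) by (rule borel_measurable_integrable)
  define S where "S \<omega> = (\<Sum>n<N. Y (\<omega> n))" for \<omega> :: "nat \<Rightarrow> 'z"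
  have [measurable]: "S \<in> borel_measurable ?Q" unfolding S_def by measurable
  have int: "integrable P (\<lambda>z. (norm (Y z))\<^sup>2)"
    using Y2(1) by (intro integrableI_nonneg) (auto intro: le_less_trans)
  have "ennreal (\<integral>z. (norm (Y z))\<^sup>2 \<partial>P) \<le> ennreal s"
    using Y2(1) by (subst nn_integral_eq_integral[OF int, symmetric]) auto
  then have int_le: "(\<integral>z. (norm (Y z))\<^sup>2 \<partial>P) \<le> s"
    using Y2(2) by simp
  have intb: "integrable P (\<lambda>z. (Y z \<bullet> b)\<^sup>2)" if "b \<in> Basis" for b
  proof (rule Bochner_Integration.integrable_bound[OF int])
    have "\<bar>Y z \<bullet> b\<bar> \<le> norm (Y z)" for z using Basis_le_norm[OF that] .
    then have "(Y z \<bullet> b)\<^sup>2 \<le> (norm (Y z))\<^sup>2" for z by (metis power2_abs power_mono abs_ge_zero)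
    then show "AE z in P. norm ((Y z \<bullet> b)\<^sup>2) \<le> norm ((norm (Y z))\<^sup>2)" by simp
  qed simp
  have nsq: "(norm x)\<^sup>2 = (\<Sum>b\<in>Basis. (x \<bullet> b)\<^sup>2)" for x :: 'a
    unfolding power2_norm_eq_inner by (subst euclidean_inner) (simp add: power2_eq_square)
  have Sb: "S \<omega> \<bullet> b = (\<Sum>n<N. Y (\<omega> n) \<bullet> b)" for \<omega> b
    by (simp add: S_def inner_sum_left)
  have mean: "integrable P (\<lambda>z. Y z \<bullet> b)" "(\<integral>z. Y z \<bullet> b \<partial>P) = 0" for b
    using Y0 by auto
  note comp = sum_square_expectation_PiM[OF P _ intb mean, where N = N]
  have intS: "integrable ?Q (\<lambda>\<omega>. (norm (S \<omega>))\<^sup>2)"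
    unfolding nsq Sb by (intro Bochner_Integration.integrable_sum comp) auto
  have "(\<integral>\<omega>. (norm (S \<omega>))\<^sup>2 \<partial>?Q) = (\<Sum>b\<in>Basis. \<integral>\<omega>. (\<Sum>n<N. Y (\<omega> n) \<bullet> b)\<^sup>2 \<partial>?Q)"
    unfolding nsq Sb by (intro Bochner_Integration.integral_sum comp) auto
  also have "\<dots> = (\<Sum>b\<in>Basis. real N * (\<integral>z. (Y z \<bullet> b)\<^sup>2 \<partial>P))"
    by (intro sum.cong comp) auto
  also have "\<dots> = real N * (\<integral>z. (norm (Y z))\<^sup>2 \<partial>P)"
    unfolding nsq sum_distrib_left[symmetric] using intb
    by (subst Bochner_Integration.integral_sum) auto
  finally have ES: "(\<integral>\<omega>. (norm (S \<omega>))\<^sup>2 \<partial>?Q) \<le> real N * s"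
    using int_le by (simp add: mult_left_mono)
  let ?c = "(real N * a)\<^sup>2"
  let ?good = "{\<omega> \<in> space ?Q. norm (S \<omega> /\<^sub>R real N) \<le> a}"
  let ?bad = "{\<omega> \<in> space ?Q. ?c \<le> (norm (S \<omega>))\<^sup>2}"
  have c: "0 < ?c" using N a by simp
  \<comment> \<open>Markov's inequality for the squared norm of the unnormalized sum; after division
    by \<open>(real N * a)^2\<close> the bound becomes \<open>s / (N * a^2)\<close>, at most
    1/3.\<close>
  have "measure ?Q ?bad \<le> (\<integral>\<omega>. (norm (S \<omega>))\<^sup>2 \<partial>?Q) / ?c"
    using intS c by (intro integral_Markov_inequality_measure[of _ _ "{}"]) auto
  also have "\<dots> \<le> real N * s / ?c" using ES by (intro divide_right_mono) auto
  also have "\<dots> \<le> 1 / 3"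
    using mult_left_mono[OF a(2), of "real N"] N a c
    by (simp add: divide_le_eq power_mult_distrib) (simp add: power2_eq_square mult.assoc)
  finally have bad: "measure ?Q ?bad \<le> 1 / 3" .
  have "space ?Q - ?bad \<subseteq> ?good"
  proof safe
    fix \<omega> assume *: "\<not> ?c \<le> (norm (S \<omega>))\<^sup>2"
    have "norm (S \<omega>) < real N * a"
    proof (rule ccontr)
      assume "\<not> norm (S \<omega>) < real N * a"
      then have "?c \<le> (norm (S \<omega>))\<^sup>2" using a by (intro power_mono) auto
      with * show False ..
    qed
    then show "norm (S \<omega> /\<^sub>R real N) \<le> a" using N by (simp add: field_simps)
  qed
  then have "measure ?Q (space ?Q - ?bad) \<le> measure ?Q ?good"
    by (intro Q.finite_measure_mono) auto
  moreover have "measure ?Q (space ?Q - ?bad) = 1 - measure ?Q ?bad"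
    by (rule Q.prob_compl) measurable
  ultimately show ?thesis using bad unfolding S_def by simp
qed

text \<open>Measurability is tested on the generating boxes, whose mass is a finite product of
  measurable factors. It allows \<open>m\<close> independent calls at a random input.\<close>

lemma measurable_PiM_prob_algebra:
  assumes "finite I" and K: "K \<in> M \<rightarrow>\<^sub>M prob_algebra N"
  shows "(\<lambda>x. PiM I (\<lambda>_. K x)) \<in> M \<rightarrow>\<^sub>M prob_algebra (PiM I (\<lambda>_. N))"
proof (rule measurable_prob_algebra_generated[OF sets_PiM Int_stable_prod_algebra prod_algebra_sets_into_space])
  fix x assume "x \<in> space M"
  then have x: "prob_space (K x)" "sets (K x) = sets N"
    using measurable_space[OF K] by (auto simp: space_prob_algebra)
  show "prob_space (PiM I (\<lambda>_. K x))" using x(1) by (rule prob_space_PiM)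
  show "sets (PiM I (\<lambda>_. K x)) = sets (PiM I (\<lambda>_. N))" using x(2) by (intro sets_PiM_cong) auto
next
  fix A assume "A \<in> prod_algebra I (\<lambda>_. N)"
  then obtain E where E: "A = Pi\<^sub>E I E" "E \<in> (\<Pi> i\<in>I. sets N)" by (rule prod_algebraE_all)
  have "(\<lambda>x. \<Prod>i\<in>I. emeasure (K x) (E i)) \<in> borel_measurable M"
    using E K by (intro borel_measurable_prod_ennreal) (auto intro!: measurable_emeasure_kernel[OF measurable_prob_algebraD])
  moreover have "emeasure (PiM I (\<lambda>_. K x)) A = (\<Prod>i\<in>I. emeasure (K x) (E i))" if "x \<in> space M" for x
  proof -
    have x: "prob_space (K x)" "sets (K x) = sets N"
      using measurable_space[OF K that] by (auto simp: space_prob_algebra)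
    interpret K: prob_space "K x" by fact
    interpret product_sigma_finite "\<lambda>_. K x" ..
    show ?thesis unfolding E(1) using E(2) x(2) assms(1) by (intro emeasure_PiM) auto
  qed
  ultimately show "(\<lambda>x. emeasure (PiM I (\<lambda>_. K x)) A) \<in> borel_measurable M"
    by (simp cong: measurable_cong)
qed

text \<open>\<open>bind\<close> reads its target sigma-algebra off the kernel at a chosen point,
  which may lie outside the support; hence the sigma-algebras must agree everywhere, while the
  measures need to agree only on the support.\<close>

lemma bind_measure_pmf_cong_sets:
  assumes "\<And>x. sets (f x) = sets N" "\<And>x. sets (g x) = sets N" "\<And>x. x \<in> set_pmf p \<Longrightarrow> f x = g x"
  shows "bind (measure_pmf p) f = bind (measure_pmf p) g"
proof -
  have sub: "subprob_algebra (f x) = subprob_algebra N" "subprob_algebra (g x) = subprob_algebra N" for x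
    using assms by (auto intro: subprob_algebra_cong)
  have "emeasure (measure_pmf p) (f -` A) = emeasure (measure_pmf p) (g -` A)" for A
    by (rule emeasure_eq_AE) (auto simp: AE_measure_pmf_iff assms(3))
  then have "distr (measure_pmf p) (subprob_algebra N) f = distr (measure_pmf p) (subprob_algebra N) g"
    by (simp add: distr_def)
  then show ?thesis by (simp add: bind_nonempty sub)
qed

section \<open>Kernels of a robust gap estimation run\<close>

text \<open>By \<open>majority_radius_le_iff\<close> the sublevel sets are conditions on how many
  measurable events occur.\<close>

lemma measurable_majority_radius:
  fixes \<rho> :: "'w \<Rightarrow> 'b \<Rightarrow> 'b \<Rightarrow> ereal"
  assumes "0 < m" and [measurable]: "\<And>k. k < m \<Longrightarrow> (\<lambda>\<omega>. \<rho> \<omega> (y \<omega> i) (y \<omega> k)) \<in> borel_measurable M"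
  shows "(\<lambda>\<omega>. majority_radius m (\<rho> \<omega>) (y \<omega>) i) \<in> borel_measurable M"
proof (rule borel_measurableI_le)
  fix R
  have "{\<omega> \<in> space M. k \<in> {k. k < m \<and> \<rho> \<omega> (y \<omega> i) (y \<omega> k) \<le> R}} \<in> sets M" for k
    by (cases "k < m") auto
  then have [measurable]: "(\<lambda>\<omega>. card {k. k < m \<and> \<rho> \<omega> (y \<omega> i) (y \<omega> k) \<le> R}) \<in> M \<rightarrow>\<^sub>M count_space UNIV"
    by (rule measurable_card)
  show "{\<omega> \<in> space M. majority_radius m (\<rho> \<omega>) (y \<omega>) i \<le> R} \<in> sets M"
    unfolding majority_radius_le_iff[OF assms(1)] by measurable
qed

lemma measurable_in_Extract:
  fixes \<rho> :: "'w \<Rightarrow> 'b \<Rightarrow> 'b \<Rightarrow> ereal"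
  assumes "\<And>i k. i < m \<Longrightarrow> k < m \<Longrightarrow> (\<lambda>\<omega>. \<rho> \<omega> (y \<omega> i) (y \<omega> k)) \<in> borel_measurable M"
  shows "Measurable.pred M (\<lambda>\<omega>. i \<in> Extract m (\<rho> \<omega>) (y \<omega>))"
proof (cases "i < m")
  case True
  then have [measurable]: "(\<lambda>\<omega>. majority_radius m (\<rho> \<omega>) (y \<omega>) k) \<in> borel_measurable M" if "k < m" for k
    using assms that by (intro measurable_majority_radius) auto
  have "{\<omega> \<in> space M. k \<in> {k. k < m \<and> majority_radius m (\<rho> \<omega>) (y \<omega>) k < majority_radius m (\<rho> \<omega>) (y \<omega>) i}} \<in> sets M" for k
    using True by (cases "k < m") auto
  then have [measurable]: "(\<lambda>\<omega>. card {k. k < m \<and> majority_radius m (\<rho> \<omega>) (y \<omega>) k < majority_radius m (\<rho> \<omega>) (y \<omega>) i})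
      \<in> M \<rightarrow>\<^sub>M count_space UNIV"
    by (rule measurable_card)
  show ?thesis unfolding Extract_iff by measurable
qed (simp add: Extract_iff)

text \<open>Gathers what makes the law of one run well behaved as a measure; the function
  \<open>g\<close> and the success probability of the procedure enter only in later lemmas.\<close>

locale robust_gap_setup =
  fixes \<mu> L \<sigma> :: real and P :: "'z measure" and G :: "'a::euclidean_space \<Rightarrow> 'z \<Rightarrow> 'a"
    and h :: "'a \<Rightarrow> ereal" and m :: nat and pen \<epsilon> :: real and c :: "('a, 'z) choices"
  assumes prob_P: "prob_space P"
    and G_measurable [measurable]: "(\<lambda>(x, z). G x z) \<in> borel_measurable (borel \<Otimes>\<^sub>M P)"
    and closed_convex_h: "closed_convex h"
    and admissible: "admissible_choices \<mu> L \<sigma> P G h m pen \<epsilon> c"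
begin

definition N where "N = sample_size \<mu> L \<sigma> pen \<epsilon>"

abbreviation U :: "(nat \<Rightarrow> 'a) measure" where "U \<equiv> PiM {..<m} (\<lambda>_. borel)"
abbreviation S :: "(nat \<Rightarrow> nat \<Rightarrow> 'z) measure" where "S \<equiv> PiM {..<m} (\<lambda>_. PiM {..<N} (\<lambda>_. P))"

lemma N_pos: "0 < N"
  by (simp add: N_def sample_size_def Let_def)

lemma h_measurable [measurable]: "h \<in> borel_measurable borel"
  using closed_convex_h by (rule closed_convex_borel_measurable)

lemma prob_S: "prob_space S"
  by (intro prob_space_PiM prob_P)

lemma
  shows pick_point_measurable:
      "(\<lambda>(x\<^sub>c, u). measure_pmf (pick_point c x\<^sub>c u)) \<in> borel \<Otimes>\<^sub>M U \<rightarrow>\<^sub>M prob_algebra (count_space UNIV)"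
    and pick_grad_measurable:
      "(\<lambda>(x\<^sub>c, u, Z). measure_pmf (pick_grad c x\<^sub>c u i Z)) \<in> borel \<Otimes>\<^sub>M U \<Otimes>\<^sub>M S \<rightarrow>\<^sub>M prob_algebra (count_space UNIV)"
    and pick_output_measurable:
      "(\<lambda>(x\<^sub>c, u, Z). measure_pmf (pick_output c x\<^sub>c u i Z k)) \<in> borel \<Otimes>\<^sub>M U \<Otimes>\<^sub>M S \<rightarrow>\<^sub>M prob_algebra (count_space UNIV)"
  using admissible by (auto simp: admissible_choices_def Let_def N_def)

lemma set_pick_point:
  assumes "0 < m" "u \<in> space U"
  shows "set_pmf (pick_point c x\<^sub>c u) \<subseteq> Extract m rho_norm u"
proof -
  have "picks_from (pick_point c x\<^sub>c u) (Extract m rho_norm u)"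
    using admissible assms(2) unfolding admissible_choices_def Let_def by blast
  with Extract_nonempty[OF assms(1), of rho_norm u] show ?thesis by (simp add: picks_from_def)
qed

lemma set_pick_grad:
  assumes "i < m" "u \<in> space U" "Z \<in> space S"
  shows "set_pmf (pick_grad c x\<^sub>c u i Z) \<subseteq> center_set m (grad_average G pen x\<^sub>c N (u i) Z)"
proof -
  have "picks_from (pick_grad c x\<^sub>c u i Z) (center_set m (grad_average G pen x\<^sub>c N (u i) Z))"
    using admissible assms unfolding admissible_choices_def Let_def N_def[symmetric] by blast
  then show ?thesis
    using center_set_nonempty[of m] assms(1) by (auto simp: picks_from_def)
qed

lemma set_pick_output:
  assumes "i < m" "k < m" "u \<in> space U" "Z \<in> space S"
    and "Extract m rho_norm u \<inter> Extract m (rho_grad h (grad_average G pen x\<^sub>c N (u i) Z k)) u \<noteq> {}"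
  shows "set_pmf (pick_output c x\<^sub>c u i Z k) \<subseteq>
    Extract m rho_norm u \<inter> Extract m (rho_grad h (grad_average G pen x\<^sub>c N (u i) Z k)) u"
proof -
  have "picks_from (pick_output c x\<^sub>c u i Z k)
    (Extract m rho_norm u \<inter> Extract m (rho_grad h (grad_average G pen x\<^sub>c N (u i) Z k)) u)"
    using admissible assms(1-4) unfolding admissible_choices_def Let_def N_def[symmetric] by blast
  with assms(5) show ?thesis by (simp add: picks_from_def)
qed

text \<open>The innermost of four conditional laws that peel off the random steps of
  \<open>RobustGap\<close>; \<open>grad_law\<close>, \<open>sample_law\<close> and
  \<open>run_law\<close> follow, each fixing only the draws made before it.\<close>

definition output_law :: "'a \<Rightarrow> (nat \<Rightarrow> 'a) \<Rightarrow> nat \<Rightarrow> (nat \<Rightarrow> nat \<Rightarrow> 'z) \<Rightarrow> nat \<Rightarrow> 'a measure" where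
  "output_law x\<^sub>c u i Z k =
    (if Extract m rho_norm u \<inter> Extract m (rho_grad h (grad_average G pen x\<^sub>c N (u i) Z k)) u = {}
     then null_measure borel
     else measure_pmf (pick_output c x\<^sub>c u i Z k) \<bind> (\<lambda>l. return borel (u l)))"

lemma sets_output_law [simp]: "sets (output_law x\<^sub>c u i Z k) = sets borel"
  by (simp add: output_law_def)

lemma component_measurable:
  assumes "i < m"
  shows "(\<lambda>(x\<^sub>c, u, Z). u i) \<in> borel_measurable (borel \<Otimes>\<^sub>M U \<Otimes>\<^sub>M S)"
proof -
  have [measurable]: "(\<lambda>u. u i) \<in> U \<rightarrow>\<^sub>M borel" using assms by (intro measurable_component_singleton) simp
  show ?thesis by measurable
qed

lemma grad_average_measurable:
  assumes "i < m" "k < m"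
  shows "(\<lambda>(x\<^sub>c, u, Z). grad_average G pen x\<^sub>c N (u i) Z k) \<in> borel_measurable (borel \<Otimes>\<^sub>M U \<Otimes>\<^sub>M S)"
proof -
  have "(\<lambda>(x\<^sub>c, u, Z). G (u i) (Z k n)) \<in> borel_measurable (borel \<Otimes>\<^sub>M U \<Otimes>\<^sub>M S)" if "n < N" for n
  proof -
    have [measurable]: "(\<lambda>u. u i) \<in> U \<rightarrow>\<^sub>M borel" using assms by (intro measurable_component_singleton) simp
    have [measurable]: "(\<lambda>Z. Z k n) \<in> S \<rightarrow>\<^sub>M P"
      using assms that by (intro measurable_compose[OF measurable_component_singleton[of k] measurable_component_singleton[of n "{..<N}" "\<lambda>_. P"]]) auto
    have "(\<lambda>(x\<^sub>c, u, Z). (u i, Z k n)) \<in> borel \<Otimes>\<^sub>M U \<Otimes>\<^sub>M S \<rightarrow>\<^sub>M borel \<Otimes>\<^sub>M P"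
      by measurable
    from measurable_compose[OF this G_measurable] show ?thesis by (simp add: split_beta')
  qed
  then have [measurable]: "(\<lambda>\<omega>. G (fst (snd \<omega>) i) (snd (snd \<omega>) k n)) \<in> borel_measurable (borel \<Otimes>\<^sub>M U \<Otimes>\<^sub>M S)" if "n < N" for n
    using that by (simp add: split_beta')
  have [measurable]: "(\<lambda>\<omega>. fst (snd \<omega>) i) \<in> borel_measurable (borel \<Otimes>\<^sub>M U \<Otimes>\<^sub>M S)"
    using component_measurable[OF assms(1)] by (simp add: split_beta')
  have "(\<lambda>\<omega>. (\<Sum>n<N. G (fst (snd \<omega>) i) (snd (snd \<omega>) k n) + pen *\<^sub>R (fst (snd \<omega>) i - fst \<omega>)) /\<^sub>R real N)
      \<in> borel_measurable (borel \<Otimes>\<^sub>M U \<Otimes>\<^sub>M S)"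
    by (intro borel_measurable_scaleR borel_measurable_const borel_measurable_sum borel_measurable_add
        borel_measurable_diff) simp_all
  then show ?thesis by (simp add: grad_average_def split_beta')
qed

lemma output_law_measurable:
  assumes "i < m" "k < m"
  shows "(\<lambda>(x\<^sub>c, u, Z). output_law x\<^sub>c u i Z k) \<in> borel \<Otimes>\<^sub>M U \<Otimes>\<^sub>M S \<rightarrow>\<^sub>M subprob_algebra borel"
proof -
  let ?X = "borel \<Otimes>\<^sub>M U \<Otimes>\<^sub>M S"
  \<comment> \<open>The output kernel is defined for every natural index, so indices beyond
    \<open>m\<close> are needed as well; there a point of the product space has the constant value
    \<open>undefined\<close>.\<close>
  have u [measurable]: "(\<lambda>\<omega>. fst (snd \<omega>) j) \<in> borel_measurable ?X" for j
  proof (cases "j < m")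
    case True
    then show ?thesis using component_measurable[of j] by (simp add: split_beta')
  next
    case False
    then have "fst (snd \<omega>) j = undefined" if "\<omega> \<in> space ?X" for \<omega>
      using that by (auto simp: space_pair_measure space_PiM PiE_def extensional_def)
    then show ?thesis by (subst measurable_cong[where g = "\<lambda>_. undefined"]) auto
  qed
  define v where "v \<omega> = grad_average G pen (fst \<omega>) N (fst (snd \<omega>) i) (snd (snd \<omega>)) k" for \<omega>
  have [measurable]: "v \<in> borel_measurable ?X"
    using grad_average_measurable[OF assms] by (simp add: v_def[abs_def] split_beta')
  have [measurable]: "Measurable.pred ?X (\<lambda>\<omega>. l \<in> Extract m rho_norm (fst (snd \<omega>)))" for l
    by (intro measurable_in_Extract) (simp add: rho_norm_def)
  have [measurable]: "Measurable.pred ?X (\<lambda>\<omega>. l \<in> Extract m (rho_grad h (v \<omega>)) (fst (snd \<omega>)))" for l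
    by (intro measurable_in_Extract) (unfold rho_grad_def, measurable)
  have "Extract m rho_norm u \<inter> Extract m (rho_grad h w) u = {} \<longleftrightarrow>
      (\<forall>l\<in>{..<m}. \<not> (l \<in> Extract m rho_norm u \<and> l \<in> Extract m (rho_grad h w) u))" for u w
    by (auto simp: Extract_def)
  then have [measurable]: "Measurable.pred ?X
      (\<lambda>\<omega>. Extract m rho_norm (fst (snd \<omega>)) \<inter> Extract m (rho_grad h (v \<omega>)) (fst (snd \<omega>)) = {})"
    by (simp only:) measurable
  have "(\<lambda>\<omega>. measure_pmf (pick_output c (fst \<omega>) (fst (snd \<omega>)) i (snd (snd \<omega>)) k) \<bind> (\<lambda>l. return borel (fst (snd \<omega>) l)))
      \<in> ?X \<rightarrow>\<^sub>M subprob_algebra borel"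
  proof (rule measurable_bind'[where N = "count_space UNIV"])
    show "(\<lambda>\<omega>. measure_pmf (pick_output c (fst \<omega>) (fst (snd \<omega>)) i (snd (snd \<omega>)) k)) \<in> ?X \<rightarrow>\<^sub>M subprob_algebra (count_space UNIV)"
      using measurable_prob_algebraD[OF pick_output_measurable] by (simp add: split_beta')
    have "(\<lambda>p. (\<lambda>l \<omega>. return borel (fst (snd \<omega>) l)) (snd p) (fst p)) \<in> ?X \<Otimes>\<^sub>M count_space UNIV \<rightarrow>\<^sub>M subprob_algebra borel"
      by (rule measurable_compose_countable'[where I = UNIV])
        (auto intro!: measurable_compose[OF _ return_measurable] measurable_compose[OF measurable_fst u])
    then show "(\<lambda>(\<omega>, l). return borel (fst (snd \<omega>) l)) \<in> ?X \<Otimes>\<^sub>M count_space UNIV \<rightarrow>\<^sub>M subprob_algebra borel"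
      by (simp add: split_beta')
  qed
  then have "(\<lambda>\<omega>. output_law (fst \<omega>) (fst (snd \<omega>)) i (snd (snd \<omega>)) k) \<in> ?X \<rightarrow>\<^sub>M subprob_algebra borel"
    unfolding output_law_def v_def[symmetric]
    by (intro measurable_If) (auto intro!: measurable_const)
  then show ?thesis by (simp add: split_beta')
qed

end

lemma no_majority_measurable:
  assumes "C \<in> sets N"
  shows "{\<omega> \<in> space (PiM {..<m} (\<lambda>_. N)). 2 * card {k. k < m \<and> \<omega> k \<in> C} \<le> m} \<in> sets (PiM {..<m} (\<lambda>_. N))"
proof -
  let ?P = "PiM {..<m} (\<lambda>_. N)"
  have "{\<omega> \<in> space ?P. k \<in> {k. k < m \<and> \<omega> k \<in> C}} \<in> sets ?P" for k
    using assms by (cases "k < m") (auto intro!: measurable_sets_Collect[of "\<lambda>\<omega>. \<omega> k" ?P N] simp: measurable_component_singleton)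
  then have "(\<lambda>\<omega>. card {k. k < m \<and> \<omega> k \<in> C}) \<in> ?P \<rightarrow>\<^sub>M count_space UNIV" by (rule measurable_card)
  then have "(\<lambda>\<omega>. card {k. k < m \<and> \<omega> k \<in> C}) -` {n. 2 * n \<le> m} \<inter> space ?P \<in> sets ?P"
    by (rule measurable_sets) simp
  also have "(\<lambda>\<omega>. card {k. k < m \<and> \<omega> k \<in> C}) -` {n. 2 * n \<le> m} \<inter> space ?P =
      {\<omega> \<in> space ?P. 2 * card {k. k < m \<and> \<omega> k \<in> C} \<le> m}"
    by blast
  finally show ?thesis .
qed

section \<open>Conditional laws of a run and their measurability\<close>

context robust_gap_setup
begin

text \<open>For \<open>k \<ge> m\<close> the average \<open>grad_average \<dots> k\<close> need not be measurable in the sampling point, because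
  then \<open>Z k n\<close> is a fixed junk value that may lie outside \<open>space P\<close>. Such indices are drawn with
  probability zero; clamping them makes the kernels measurable everywhere.\<close>

definition clamp :: "nat \<Rightarrow> nat" where
  "clamp i = min i (m - 1)"

lemma clamp_less: "0 < m \<Longrightarrow> clamp i < m"
  by (auto simp: clamp_def)

lemma clamp_id: "i < m \<Longrightarrow> clamp i = i"
  by (auto simp: clamp_def)

definition grad_law :: "'a \<Rightarrow> (nat \<Rightarrow> 'a) \<Rightarrow> nat \<Rightarrow> (nat \<Rightarrow> nat \<Rightarrow> 'z) \<Rightarrow> 'a measure" where
  "grad_law x\<^sub>c u i Z = measure_pmf (pick_grad c x\<^sub>c u i Z) \<bind> (\<lambda>k. output_law x\<^sub>c u i Z (clamp k))"

definition sample_law :: "'a \<Rightarrow> (nat \<Rightarrow> 'a) \<Rightarrow> nat \<Rightarrow> 'a measure" where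
  "sample_law x\<^sub>c u i = S \<bind> grad_law x\<^sub>c u i"

definition run_law :: "'a \<Rightarrow> (nat \<Rightarrow> 'a) \<Rightarrow> 'a measure" where
  "run_law x\<^sub>c u = measure_pmf (pick_point c x\<^sub>c u) \<bind> (\<lambda>i. sample_law x\<^sub>c u (clamp i))"

lemma space_S_nonempty: "space S \<noteq> {}"
  using prob_S by (rule prob_space.not_empty)

lemma sets_grad_law [simp]: "sets (grad_law x\<^sub>c u i Z) = sets borel"
  by (simp add: grad_law_def)

lemma sets_sample_law [simp]: "sets (sample_law x\<^sub>c u i) = sets borel"
  unfolding sample_law_def using space_S_nonempty by (intro sets_bind) auto

lemma grad_law_measurable:
  assumes "i < m"
  shows "(\<lambda>(x\<^sub>c, u, Z). grad_law x\<^sub>c u i Z) \<in> borel \<Otimes>\<^sub>M U \<Otimes>\<^sub>M S \<rightarrow>\<^sub>M subprob_algebra borel"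
proof -
  let ?X = "borel \<Otimes>\<^sub>M U \<Otimes>\<^sub>M S"
  have out: "(\<lambda>\<omega>. output_law (fst \<omega>) (fst (snd \<omega>)) i (snd (snd \<omega>)) (clamp k)) \<in> ?X \<rightarrow>\<^sub>M subprob_algebra borel" for k
    using output_law_measurable[OF assms clamp_less, of k] assms by (simp add: split_beta')
  have "(\<lambda>\<omega>. grad_law (fst \<omega>) (fst (snd \<omega>)) i (snd (snd \<omega>))) \<in> ?X \<rightarrow>\<^sub>M subprob_algebra borel"
    unfolding grad_law_def
  proof (rule measurable_bind'[where N = "count_space UNIV"])
    show "(\<lambda>\<omega>. measure_pmf (pick_grad c (fst \<omega>) (fst (snd \<omega>)) i (snd (snd \<omega>)))) \<in> ?X \<rightarrow>\<^sub>M subprob_algebra (count_space UNIV)"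
      using measurable_prob_algebraD[OF pick_grad_measurable] by (simp add: split_beta')
    have "(\<lambda>p. (\<lambda>k \<omega>. output_law (fst \<omega>) (fst (snd \<omega>)) i (snd (snd \<omega>)) (clamp k)) (snd p) (fst p))
        \<in> ?X \<Otimes>\<^sub>M count_space UNIV \<rightarrow>\<^sub>M subprob_algebra borel"
      by (rule measurable_compose_countable'[where I = UNIV]) (auto intro!: measurable_compose[OF measurable_fst out])
    then show "(\<lambda>(\<omega>, k). output_law (fst \<omega>) (fst (snd \<omega>)) i (snd (snd \<omega>)) (clamp k))
        \<in> ?X \<Otimes>\<^sub>M count_space UNIV \<rightarrow>\<^sub>M subprob_algebra borel"
      by (simp add: split_beta')
  qed
  then show ?thesis by (simp add: split_beta')
qed

lemma sample_law_measurable: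
  assumes "i < m"
  shows "(\<lambda>(x\<^sub>c, u). sample_law x\<^sub>c u i) \<in> borel \<Otimes>\<^sub>M U \<rightarrow>\<^sub>M subprob_algebra borel"
proof -
  have "(\<lambda>p. (fst (fst p), snd (fst p), snd p)) \<in> (borel \<Otimes>\<^sub>M U) \<Otimes>\<^sub>M S \<rightarrow>\<^sub>M borel \<Otimes>\<^sub>M U \<Otimes>\<^sub>M S"
    by measurable
  from measurable_compose[OF this grad_law_measurable[OF assms]]
  have "(\<lambda>p. bind S (grad_law (fst p) (snd p) i)) \<in> borel \<Otimes>\<^sub>M U \<rightarrow>\<^sub>M subprob_algebra borel"
    using prob_S by (intro measurable_bind'[where N = S] measurable_const)
      (auto simp: split_beta' space_subprob_algebra prob_space_imp_subprob_space)
  then show ?thesis by (simp add: sample_law_def split_beta')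
qed

lemma run_law_measurable:
  assumes "0 < m"
  shows "(\<lambda>(x\<^sub>c, u). run_law x\<^sub>c u) \<in> borel \<Otimes>\<^sub>M U \<rightarrow>\<^sub>M subprob_algebra borel"
proof -
  have sam: "(\<lambda>p. sample_law (fst p) (snd p) (clamp i)) \<in> borel \<Otimes>\<^sub>M U \<rightarrow>\<^sub>M subprob_algebra borel" for i
    using sample_law_measurable[OF clamp_less[OF assms], of i] by (simp add: split_beta')
  have "(\<lambda>p. run_law (fst p) (snd p)) \<in> borel \<Otimes>\<^sub>M U \<rightarrow>\<^sub>M subprob_algebra borel"
    unfolding run_law_def
  proof (rule measurable_bind'[where N = "count_space UNIV"])
    show "(\<lambda>p. measure_pmf (pick_point c (fst p) (snd p))) \<in> borel \<Otimes>\<^sub>M U \<rightarrow>\<^sub>M subprob_algebra (count_space UNIV)"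
      using measurable_prob_algebraD[OF pick_point_measurable] by (simp add: split_beta')
    have "(\<lambda>q. (\<lambda>i p. sample_law (fst p) (snd p) (clamp i)) (snd q) (fst q))
        \<in> (borel \<Otimes>\<^sub>M U) \<Otimes>\<^sub>M count_space UNIV \<rightarrow>\<^sub>M subprob_algebra borel"
      by (rule measurable_compose_countable'[where I = UNIV]) (auto intro!: measurable_compose[OF measurable_fst sam])
    then show "(\<lambda>(p, i). sample_law (fst p) (snd p) (clamp i))
        \<in> (borel \<Otimes>\<^sub>M U) \<Otimes>\<^sub>M count_space UNIV \<rightarrow>\<^sub>M subprob_algebra borel"
      by (simp add: split_beta')
  qed
  then show ?thesis by (simp add: split_beta')
qed

lemma grad_law_kernel:
  assumes "i < m" "u \<in> space U"
  shows "grad_law x\<^sub>c u i \<in> S \<rightarrow>\<^sub>M subprob_algebra borel"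
  using measurable_compose[OF _ grad_law_measurable[OF assms(1)], of "\<lambda>Z. (x\<^sub>c, u, Z)" S] assms(2) by simp

lemma run_law_kernel:
  assumes "0 < m"
  shows "run_law x\<^sub>c \<in> U \<rightarrow>\<^sub>M subprob_algebra borel"
  using measurable_compose[OF _ run_law_measurable[OF assms], of "\<lambda>u. (x\<^sub>c, u)" U] by simp

lemma output_law_space:
  assumes "i < m" "k < m" "u \<in> space U" "Z \<in> space S"
  shows "output_law x\<^sub>c u i Z k \<in> space (subprob_algebra borel)"
  using measurable_space[OF output_law_measurable[OF assms(1,2)], of "(x\<^sub>c, u, Z)"] assms
  by (simp add: space_pair_measure)

lemma sample_law_space:
  assumes "i < m" "u \<in> space U"
  shows "sample_law x\<^sub>c u i \<in> space (subprob_algebra borel)"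
  using measurable_space[OF sample_law_measurable[OF assms(1)], of "(x\<^sub>c, u)"] assms
  by (simp add: space_pair_measure)

text \<open>Admissible picks are supported on indices below \<open>m\<close>, so clamping alters the
  kernels only off the supports.\<close>

lemma RobustGap_eq_run_law:
  assumes "0 < m" "M \<in> space (prob_algebra borel)"
  shows "RobustGap \<mu> L \<sigma> P G h c pen M m \<epsilon> x\<^sub>c = PiM {..<m} (\<lambda>_. M) \<bind> run_law x\<^sub>c"
proof -
  have space: "space (PiM {..<m} (\<lambda>_. M)) = space U"
    using assms(2) by (auto simp: space_prob_algebra space_PiM dest: sets_eq_imp_space_eq)
  have "(measure_pmf (pick_point c x\<^sub>c u) \<bind> (\<lambda>i. S \<bind> (\<lambda>Z. measure_pmf (pick_grad c x\<^sub>c u i Z) \<bind>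
      output_law x\<^sub>c u i Z))) = run_law x\<^sub>c u" if u: "u \<in> space U" for u
    unfolding run_law_def
  proof (rule bind_measure_pmf_cong_sets[where N = borel])
    fix i
    show "sets (S \<bind> (\<lambda>Z. measure_pmf (pick_grad c x\<^sub>c u i Z) \<bind> output_law x\<^sub>c u i Z)) = sets borel"
      using space_S_nonempty by (intro sets_bind) auto
    assume "i \<in> set_pmf (pick_point c x\<^sub>c u)"
    then have i: "i < m" using set_pick_point[OF assms(1) u] by (auto simp: Extract_def)
    show "S \<bind> (\<lambda>Z. measure_pmf (pick_grad c x\<^sub>c u i Z) \<bind> output_law x\<^sub>c u i Z) = sample_law x\<^sub>c u (clamp i)"
      unfolding sample_law_def clamp_id[OF i] grad_law_def
    proof (rule bind_cong[OF refl], rule bind_measure_pmf_cong_sets[where N = borel])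
      fix Z k assume "Z \<in> space S" "k \<in> set_pmf (pick_grad c x\<^sub>c u i Z)"
      then have "k < m" using set_pick_grad[OF i u] by (auto simp: center_set_eq)
      then show "output_law x\<^sub>c u i Z k = output_law x\<^sub>c u i Z (clamp k)" by (simp add: clamp_id)
    qed auto
  qed auto
  then show ?thesis
    unfolding RobustGap_def Let_def N_def[symmetric] output_law_def[symmetric]
    by (intro bind_cong refl) (simp add: space)
qed

text \<open>Without candidates both extracted sets are empty, so the run returns nothing.\<close>

lemma RobustGap_zero:
  assumes "m = 0" "M \<in> space (prob_algebra borel)"
  shows "RobustGap \<mu> L \<sigma> P G h c pen M m \<epsilon> x\<^sub>c = null_measure borel"
proof -
  have "prob_space (PiM {..<m} (\<lambda>_. M))"
    using assms(2) by (auto simp: space_prob_algebra intro: prob_space_PiM)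
  moreover have "subprob_space (null_measure (borel :: 'a measure))"
    by (simp add: subprob_space_null_measure_iff)
  moreover have "Extract m \<rho> y = {}" for \<rho> :: "'a \<Rightarrow> 'a \<Rightarrow> ereal" and y
    by (simp add: Extract_def assms(1))
  ultimately show ?thesis
    using prob_S unfolding RobustGap_def Let_def N_def[symmetric]
    by (simp add: bind_const' measure_pmf.prob_space_axioms)
qed

lemma RobustGap_measurable:
  assumes K: "K \<in> borel \<rightarrow>\<^sub>M prob_algebra borel"
  shows "(\<lambda>x. RobustGap \<mu> L \<sigma> P G h c pen (K x) m \<epsilon> x) \<in> borel \<rightarrow>\<^sub>M subprob_algebra borel"
proof -
  have K_space: "K x \<in> space (prob_algebra borel)" for x using measurable_space[OF K] by simp
  show ?thesis
  proof (cases "0 < m")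
    case True
    then show ?thesis
      unfolding RobustGap_eq_run_law[OF True K_space]
      by (intro measurable_bind'[where N = U] run_law_measurable
          measurable_prob_algebraD[OF measurable_PiM_prob_algebra[OF _ K]]) auto
  next
    case False
    then show ?thesis
      using RobustGap_zero[OF _ K_space] by simp
  qed
qed

text \<open>For odd \<open>m\<close> the null branch is never taken, so every kernel in the chain is
  a probability kernel.\<close>

lemma RobustGap_prob_space:
  assumes "odd m" and M: "M \<in> space (prob_algebra borel)"
  shows "prob_space (RobustGap \<mu> L \<sigma> P G h c pen M m \<epsilon> x\<^sub>c)"
proof -
  have m: "0 < m" using assms(1) by (rule odd_pos)
  have PM: "PiM {..<m} (\<lambda>_. M) \<in> space (prob_algebra U)"
    using measurable_space[OF measurable_PiM_prob_algebra[OF finite_lessThan[of m] measurable_const[OF M, of "borel :: 'a measure"]]] by simp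
  have sets: "sets (PiM {..<m} (\<lambda>_. M)) = sets U" using PM by (simp add: space_prob_algebra)
  have ret: "return borel x \<in> space (subprob_algebra borel)" for x :: 'a
    by (simp add: space_subprob_algebra prob_space_return prob_space_imp_subprob_space)
  have out: "prob_space (output_law x\<^sub>c u i Z k)" for u i Z k
    unfolding output_law_def using Extract_intersect_odd[OF assms(1)]
    by (auto intro!: prob_space.prob_space_bind[where S = borel] simp: ret measure_pmf.prob_space_axioms prob_space_return)
  have grad: "prob_space (grad_law x\<^sub>c u i Z)" if "i < m" "u \<in> space U" "Z \<in> space S" for u i Z
    unfolding grad_law_def using output_law_space[OF that(1) clamp_less[OF m] that(2,3)] out
    by (intro prob_space.prob_space_bind[where S = borel]) (auto simp: measure_pmf.prob_space_axioms)
  have sample: "prob_space (sample_law x\<^sub>c u i)" if "i < m" "u \<in> space U" for u i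
    unfolding sample_law_def using grad_law_kernel[OF that] grad[OF that] prob_S
    by (intro prob_space.prob_space_bind[where S = borel]) auto
  have run: "prob_space (run_law x\<^sub>c u)" if "u \<in> space U" for u
    unfolding run_law_def using sample[OF clamp_less[OF m] that] sample_law_space[OF clamp_less[OF m] that]
    by (intro prob_space.prob_space_bind[where S = borel]) (auto simp: measure_pmf.prob_space_axioms)
  show ?thesis
    unfolding RobustGap_eq_run_law[OF m M]
  proof (rule prob_space.prob_space_bind[where S = borel])
    show "prob_space (PiM {..<m} (\<lambda>_. M))" using PM by (simp add: space_prob_algebra)
    show "AE u in PiM {..<m} (\<lambda>_. M). prob_space (run_law x\<^sub>c u)"
      using run sets_eq_imp_space_eq[OF sets] by auto
    show "run_law x\<^sub>c \<in> PiM {..<m} (\<lambda>_. M) \<rightarrow>\<^sub>M subprob_algebra borel"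
      using run_law_kernel[OF m] by (simp cong: measurable_cong_sets add: sets)
  qed
qed

section \<open>Failure probability of a single run\<close>

definition sample_average :: "'a \<Rightarrow> 'a \<Rightarrow> (nat \<Rightarrow> 'z) \<Rightarrow> 'a" where
  "sample_average x\<^sub>c x z = (\<Sum>n<N. G x (z n) + pen *\<^sub>R (x - x\<^sub>c)) /\<^sub>R real N"

text \<open>Shows that average number \<open>k\<close> depends on the samples only through block
  \<open>k\<close>; a good average is thus an event on one factor of the product, as
  \<open>prob_no_majority_le\<close> requires.\<close>

lemma grad_average_eq: "grad_average G pen x\<^sub>c N x Z k = sample_average x\<^sub>c x (Z k)"
  by (simp add: grad_average_def sample_average_def)

lemma sample_average_measurable: "sample_average x\<^sub>c x \<in> PiM {..<N} (\<lambda>_. P) \<rightarrow>\<^sub>M borel"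
proof -
  have [measurable]: "G x \<in> P \<rightarrow>\<^sub>M borel"
    using measurable_compose[OF _ G_measurable, of "\<lambda>z. (x, z)" P] by simp
  show ?thesis unfolding sample_average_def by measurable
qed

text \<open>Two events are charged: no majority of candidates in \<open>A\<close>, and, for fixed
  candidates and \<open>i\<close>, no majority of averages in \<open>B (u i)\<close>. The target set
  may depend on the random point \<open>u i\<close> because the gradient samples are drawn
  afterwards. Outside both events \<open>good\<close> keeps the output away from
  \<open>X\<close>.\<close>

lemma RobustGap_bad_le:
  assumes m: "0 < m" and M: "M \<in> space (prob_algebra borel)" and X: "X \<in> sets borel"
    and A: "A \<in> sets borel" "2 / 3 \<le> measure M A"
    and B: "\<And>x. B x \<in> sets borel"
      "\<And>x. 2 / 3 \<le> measure (PiM {..<N} (\<lambda>_. P)) {z \<in> space (PiM {..<N} (\<lambda>_. P)). sample_average x\<^sub>c x z \<in> B x}"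
    and good: "\<And>u i Z k l. m < 2 * card {k. k < m \<and> u k \<in> A} \<Longrightarrow> i \<in> Extract m rho_norm u \<Longrightarrow>
      m < 2 * card {k. k < m \<and> grad_average G pen x\<^sub>c N (u i) Z k \<in> B (u i)} \<Longrightarrow>
      k \<in> center_set m (grad_average G pen x\<^sub>c N (u i) Z) \<Longrightarrow> l \<in> Extract m rho_norm u \<Longrightarrow>
      l \<in> Extract m (rho_grad h (grad_average G pen x\<^sub>c N (u i) Z k)) u \<Longrightarrow> u l \<notin> X"
  shows "emeasure (RobustGap \<mu> L \<sigma> P G h c pen M m \<epsilon> x\<^sub>c) X \<le> ennreal (2 * exp (- (real m / 18)))"
proof -
  let ?q = "exp (- (real m / 18))"
  let ?Q = "PiM {..<N} (\<lambda>_. P)"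
  let ?PM = "PiM {..<m} (\<lambda>_. M)"
  have PM: "?PM \<in> space (prob_algebra U)"
    using measurable_space[OF measurable_PiM_prob_algebra[OF finite_lessThan[of m] measurable_const[OF M, of "borel :: 'a measure"]]] by simp
  have sets: "sets ?PM = sets U" and prob_PM: "prob_space ?PM" using PM by (auto simp: space_prob_algebra)
  note space = sets_eq_imp_space_eq[OF sets]
  have prob_M: "prob_space M" and sets_M: "sets M = sets borel" using M by (auto simp: space_prob_algebra)
  have prob_Q: "prob_space ?Q" by (intro prob_space_PiM prob_P)
  \<comment> \<open>The chain is bounded from the inside out. The picks cost nothing, since the bad
    set of each is the complement of its support.\<close>
  have null: "emeasure (output_law x\<^sub>c u i Z k) X = 0"
    if u: "u \<in> space U" "m < 2 * card {k. k < m \<and> u k \<in> A}" and i: "i \<in> Extract m rho_norm u" and Z: "Z \<in> space S"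
      "m < 2 * card {k. k < m \<and> grad_average G pen x\<^sub>c N (u i) Z k \<in> B (u i)}"
      and k: "k \<in> center_set m (grad_average G pen x\<^sub>c N (u i) Z)" for u i Z k
  proof (cases "Extract m rho_norm u \<inter> Extract m (rho_grad h (grad_average G pen x\<^sub>c N (u i) Z k)) u = {}")
    case False
    have "i < m" "k < m" using i k by (auto simp: Extract_def center_set_eq)
    note out = set_pick_output[OF this u(1) Z(1) False]
    have "emeasure (measure_pmf (pick_output c x\<^sub>c u i Z k) \<bind> (\<lambda>l. return borel (u l))) X \<le> 0 + 0"
    proof (rule emeasure_bind_le_bad_set[where A = "- set_pmf (pick_output c x\<^sub>c u i Z k)" and N = "count_space UNIV" and R = borel])
      show "emeasure (measure_pmf (pick_output c x\<^sub>c u i Z k)) (- set_pmf (pick_output c x\<^sub>c u i Z k)) \<le> 0"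
        by (simp add: measure_pmf.emeasure_eq_measure measure_pmf_zero_iff)
      fix l assume "l \<notin> - set_pmf (pick_output c x\<^sub>c u i Z k)"
      with out good[OF u(2) i Z(2) k] have "u l \<notin> X" by blast
      then show "emeasure (return borel (u l)) X \<le> 0" using X by simp
    qed (use X in \<open>auto simp: space_subprob_algebra prob_space_return prob_space_imp_subprob_space measure_pmf.subprob_space_axioms\<close>)
    with False show ?thesis by (simp add: output_law_def)
  qed (use X in \<open>simp add: output_law_def\<close>)
  have grad: "emeasure (grad_law x\<^sub>c u i Z) X \<le> 0 + 0"
    if u: "u \<in> space U" "m < 2 * card {k. k < m \<and> u k \<in> A}" and i: "i \<in> Extract m rho_norm u" and Z: "Z \<in> space S"
      "m < 2 * card {k. k < m \<and> grad_average G pen x\<^sub>c N (u i) Z k \<in> B (u i)}" for u i Z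
    unfolding grad_law_def
  proof (rule emeasure_bind_le_bad_set[where A = "- set_pmf (pick_grad c x\<^sub>c u i Z)" and N = "count_space UNIV" and R = borel])
    have im: "i < m" using i by (auto simp: Extract_def)
    show "emeasure (measure_pmf (pick_grad c x\<^sub>c u i Z)) (- set_pmf (pick_grad c x\<^sub>c u i Z)) \<le> 0"
      by (simp add: measure_pmf.emeasure_eq_measure measure_pmf_zero_iff)
    show "(\<lambda>k. output_law x\<^sub>c u i Z (clamp k)) \<in> count_space UNIV \<rightarrow>\<^sub>M subprob_algebra borel"
      using output_law_space[OF im clamp_less[OF m] u(1) Z(1)] by simp
    fix k assume "k \<notin> - set_pmf (pick_grad c x\<^sub>c u i Z)"
    then have k: "k \<in> center_set m (grad_average G pen x\<^sub>c N (u i) Z)"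
      using set_pick_grad[OF im u(1) Z(1)] by auto
    then have "clamp k = k" by (intro clamp_id) (simp add: center_set_eq)
    then show "emeasure (output_law x\<^sub>c u i Z (clamp k)) X \<le> 0"
      using null[OF u i Z k] by simp
  qed (use X in \<open>auto simp: space_subprob_algebra measure_pmf.subprob_space_axioms\<close>)
  have sample: "emeasure (sample_law x\<^sub>c u i) X \<le> ennreal ?q + 0"
    if u: "u \<in> space U" "m < 2 * card {k. k < m \<and> u k \<in> A}" and i: "i \<in> Extract m rho_norm u" for u i
  proof -
    define C where "C = {z \<in> space ?Q. sample_average x\<^sub>c (u i) z \<in> B (u i)}"
    have C: "C \<in> sets ?Q"
      unfolding C_def using measurable_sets[OF sample_average_measurable B(1)[of "u i"]]
      by (simp add: vimage_def Int_def conj_commute)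
    have im: "i < m" using i by (auto simp: Extract_def)
    show ?thesis
      unfolding sample_law_def
    proof (rule emeasure_bind_le_bad_set[OF _ grad_law_kernel[OF im u(1)] X, where A = "{Z \<in> space S. 2 * card {k. k < m \<and> Z k \<in> C} \<le> m}"])
      show "S \<in> space (subprob_algebra S)"
        using prob_S by (simp add: space_subprob_algebra prob_space_imp_subprob_space)
      show "{Z \<in> space S. 2 * card {k. k < m \<and> Z k \<in> C} \<le> m} \<in> sets S"
        using C by (rule no_majority_measurable)
      show "emeasure S {Z \<in> space S. 2 * card {k. k < m \<and> Z k \<in> C} \<le> m} \<le> ennreal ?q"
        using prob_no_majority_le[OF prob_Q C, of m] B(2)[of "u i"] prob_S
        by (simp add: C_def finite_measure.emeasure_eq_measure prob_space.finite_measure)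
      fix Z assume Z: "Z \<in> space S" "Z \<notin> {Z \<in> space S. 2 * card {k. k < m \<and> Z k \<in> C} \<le> m}"
      \<comment> \<open>Membership in \<open>space ?Q\<close>, which \<open>C\<close> also demands,
        holds for all components of \<open>Z\<close> below \<open>m\<close>.\<close>
      have "{k. k < m \<and> Z k \<in> C} = {k. k < m \<and> grad_average G pen x\<^sub>c N (u i) Z k \<in> B (u i)}"
        using Z(1) by (auto simp: C_def grad_average_eq space_PiM PiE_iff)
      with Z have "m < 2 * card {k. k < m \<and> grad_average G pen x\<^sub>c N (u i) Z k \<in> B (u i)}" by simp
      from grad[OF u i Z(1) this] show "emeasure (grad_law x\<^sub>c u i Z) X \<le> 0" by simp
    qed
  qed
  have run: "emeasure (run_law x\<^sub>c u) X \<le> 0 + ennreal ?q"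
    if u: "u \<in> space U" "m < 2 * card {k. k < m \<and> u k \<in> A}" for u
    unfolding run_law_def
  proof (rule emeasure_bind_le_bad_set[where A = "- set_pmf (pick_point c x\<^sub>c u)" and N = "count_space UNIV" and R = borel])
    show "emeasure (measure_pmf (pick_point c x\<^sub>c u)) (- set_pmf (pick_point c x\<^sub>c u)) \<le> 0"
      by (simp add: measure_pmf.emeasure_eq_measure measure_pmf_zero_iff)
    show "(\<lambda>i. sample_law x\<^sub>c u (clamp i)) \<in> count_space UNIV \<rightarrow>\<^sub>M subprob_algebra borel"
      using sample_law_space[OF clamp_less[OF m] u(1)] by simp
    fix i assume "i \<notin> - set_pmf (pick_point c x\<^sub>c u)"
    then have i: "i \<in> Extract m rho_norm u" using set_pick_point[OF m u(1)] by auto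
    then have "clamp i = i" by (intro clamp_id) (simp add: Extract_def)
    with sample[OF u i] show "emeasure (sample_law x\<^sub>c u (clamp i)) X \<le> ennreal ?q" by simp
  qed (use X in \<open>auto simp: space_subprob_algebra measure_pmf.subprob_space_axioms\<close>)
  have "emeasure (?PM \<bind> run_law x\<^sub>c) X \<le> ennreal ?q + ennreal ?q"
  proof (rule emeasure_bind_le_bad_set[OF _ run_law_kernel[OF m] X, where A = "{u \<in> space U. 2 * card {k. k < m \<and> u k \<in> A} \<le> m}"])
    show "?PM \<in> space (subprob_algebra U)"
      using prob_PM sets by (simp add: space_subprob_algebra prob_space_imp_subprob_space)
    show "{u \<in> space U. 2 * card {k. k < m \<and> u k \<in> A} \<le> m} \<in> sets U"
      using A(1) by (rule no_majority_measurable)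
    show "emeasure ?PM {u \<in> space U. 2 * card {k. k < m \<and> u k \<in> A} \<le> m} \<le> ennreal ?q"
      using prob_no_majority_le[OF prob_M _ A(2), of m] A(1) sets_M prob_PM
      by (simp add: space finite_measure.emeasure_eq_measure prob_space.finite_measure)
    fix u assume "u \<in> space U" "u \<notin> {u \<in> space U. 2 * card {k. k < m \<and> u k \<in> A} \<le> m}"
    then show "emeasure (run_law x\<^sub>c u) X \<le> ennreal ?q" using run[of u] by simp
  qed
  then show ?thesis
    unfolding RobustGap_eq_run_law[OF m M] by (simp flip: ennreal_plus)
qed

end

section \<open>Proximal stages\<close>

lemma L_smooth_borel_measurable:
  assumes "L_smooth L g"
  shows "g \<in> borel_measurable borel"
proof (rule borel_measurable_continuous_onI, rule continuous_at_imp_continuous_on, rule ballI)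
  fix x
  have "(g has_derivative (\<lambda>h. h \<bullet> gradient g x)) (at x)"
    using assms by (auto simp: L_smooth_def gderiv_def)
  then show "isCont g x" by (rule has_derivative_continuous)
qed

lemma gap_prox_measurable:
  fixes g :: "'a::euclidean_space \<Rightarrow> real"
  assumes "L_smooth L g" "closed_convex h"
  shows "gap (prox_objective g h pen x) \<in> borel_measurable borel"
proof -
  note [measurable] = L_smooth_borel_measurable[OF assms(1)] closed_convex_borel_measurable[OF assms(2)]
  show ?thesis unfolding gap_def prox_objective_def by measurable
qed

text \<open>The infimum runs over an uncountable family, so topology is used: each member is
  continuous in the center, and the strict sublevel sets of the infimum are unions of open sets. The
  invariant of the outer loop needs this.\<close>

lemma INF_prox_measurable:
  fixes g :: "'a::euclidean_space \<Rightarrow> real"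
  shows "(\<lambda>x. INF z. prox_objective g h pen x z) \<in> borel_measurable borel"
proof (rule borel_measurableI_less)
  fix a :: ereal
  have cont: "continuous_on UNIV (\<lambda>x. prox_objective g h pen x z)" for z
  proof (cases "h z")
    case (real r)
    have "continuous_on UNIV (\<lambda>x. ereal (g z + pen / 2 * (norm (z - x))\<^sup>2 + r))"
      by (intro continuous_intros)
    then show ?thesis by (simp add: prox_objective_def real)
  qed (auto simp: prox_objective_def)
  have "{x. (INF z. prox_objective g h pen x z) < a} = (\<Union>z. {x. prox_objective g h pen x z < a})"
    by (auto simp: INF_less_iff)
  moreover have "open (\<Union>z. {x. prox_objective g h pen x z < a})"
    using cont by (intro open_UN ballI open_Collect_less) auto
  ultimately show "{x \<in> space borel. (INF z. prox_objective g h pen x z) < a} \<in> sets borel"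
    by simp
qed

text \<open>\<open>?d\<close> is the square of the radius at which Chebyshev's inequality is
  applied, and the sample size is three times the variance bound divided by it, rounded up.\<close>

lemma sample_size_ge:
  assumes "0 < (L + pen) / (\<mu> + pen)" "0 < \<mu> + pen" "0 < \<epsilon>"
  shows "3 * \<sigma>\<^sup>2 \<le> real (sample_size \<mu> L \<sigma> pen \<epsilon>) * ((L + pen) / (\<mu> + pen) * sqrt ((\<mu> + pen) * \<epsilon>))\<^sup>2"
proof -
  let ?d = "((L + pen) / (\<mu> + pen))\<^sup>2 * (\<mu> + pen) * \<epsilon>"
  have d: "0 < ?d" using assms by (intro mult_pos_pos zero_less_power)
  have "3 * \<sigma>\<^sup>2 / ?d \<le> real (sample_size \<mu> L \<sigma> pen \<epsilon>)"
    unfolding sample_size_def Let_def by (simp only: of_nat_max) linarith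
  then have "3 * \<sigma>\<^sup>2 \<le> real (sample_size \<mu> L \<sigma> pen \<epsilon>) * ?d"
    using d by (simp only: pos_divide_le_eq)
  also have "?d = ((L + pen) / (\<mu> + pen) * sqrt ((\<mu> + pen) * \<epsilon>))\<^sup>2"
    unfolding power_mult_distrib using assms by (subst real_sqrt_pow2) (auto simp: mult.assoc)
  finally show ?thesis .
qed

text \<open>The penalty part of each sample is deterministic and cancels, leaving the average of the
  centered oracle answers.\<close>

lemma (in robust_gap_setup) gradient_estimate_concentration:
  assumes sgo: "stochastic_gradient_oracle P G \<sigma> g"
    and "0 < (L + pen) / (\<mu> + pen)" "0 < \<mu> + pen" "0 < \<epsilon>"
  shows "2 / 3 \<le> measure (PiM {..<N} (\<lambda>_. P)) {z \<in> space (PiM {..<N} (\<lambda>_. P)).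
    norm (sample_average x\<^sub>c x z - (gradient g x + pen *\<^sub>R (x - x\<^sub>c)))
      \<le> (L + pen) / (\<mu> + pen) * sqrt ((\<mu> + pen) * \<epsilon>)}"
proof -
  define Y where "Y z = G x z - gradient g x" for z
  have Gx: "integrable P (G x)" "(\<integral>z. G x z \<partial>P) = gradient g x"
    "(\<integral>\<^sup>+z. ennreal ((norm (G x z - gradient g x))\<^sup>2) \<partial>P) \<le> ennreal (\<sigma>\<^sup>2)"
    using sgo by (auto simp: stochastic_gradient_oracle_def)
  interpret prob_space P by (rule prob_P)
  have "sample_average x\<^sub>c x z - (gradient g x + pen *\<^sub>R (x - x\<^sub>c)) = (\<Sum>n<N. Y (z n)) /\<^sub>R real N" for z
  proof -
    have "(\<Sum>n<N. Y (z n)) = (\<Sum>n<N. G x (z n) + pen *\<^sub>R (x - x\<^sub>c)) - real N *\<^sub>R (gradient g x + pen *\<^sub>R (x - x\<^sub>c))"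
      unfolding Y_def by (simp add: sum_subtractf sum.distrib algebra_simps scaleR_conv_of_real sum_constant_scaleR)
    then show ?thesis
      using N_pos by (simp add: sample_average_def scaleR_diff_right)
  qed
  moreover have "2 / 3 \<le> measure (PiM {..<N} (\<lambda>_. P)) {z \<in> space (PiM {..<N} (\<lambda>_. P)).
      norm ((\<Sum>n<N. Y (z n)) /\<^sub>R real N) \<le> (L + pen) / (\<mu> + pen) * sqrt ((\<mu> + pen) * \<epsilon>)}"
  proof (rule sample_average_concentration[OF prob_P])
    show "integrable P Y" "(\<integral>z. Y z \<partial>P) = 0"
      unfolding Y_def using Gx by (auto simp: prob_space)
    show "(\<integral>\<^sup>+z. ennreal ((norm (Y z))\<^sup>2) \<partial>P) \<le> ennreal (\<sigma>\<^sup>2)"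
      unfolding Y_def by (rule Gx)
    show "3 * \<sigma>\<^sup>2 \<le> real N * ((L + pen) / (\<mu> + pen) * sqrt ((\<mu> + pen) * \<epsilon>))\<^sup>2"
      unfolding N_def by (rule sample_size_ge[OF assms(2-4)])
    show "0 < (L + pen) / (\<mu> + pen) * sqrt ((\<mu> + pen) * \<epsilon>)"
      using assms by (intro mult_pos_pos) auto
  qed (use N_pos in auto)
  ultimately show ?thesis by simp
qed

lemma robust_gap_setup_intro:
  assumes "stochastic_gradient_oracle P G \<sigma> g" "closed_convex h"
    and "admissible_choices \<mu> L \<sigma> P G h m pen \<epsilon> c"
  shows "robust_gap_setup \<mu> L \<sigma> P G h m pen \<epsilon> c"
proof (rule robust_gap_setup.intro[OF _ _ assms(2,3)])
  show "prob_space P" "(\<lambda>(x, z). G x z) \<in> borel_measurable (borel \<Otimes>\<^sub>M P)"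
    using assms(1) unfolding stochastic_gradient_oracle_def by blast+
qed

text \<open>Joins the probabilistic and the deterministic half: \<open>A\<close> is the set of
  points with gap at most \<open>\<epsilon>\<close>, \<open>B\<close> a ball around the penalized
  gradient, and the majorities yield both premises of \<open>disjoint\<close> for the
  output.\<close>

lemma RobustGap_stage:
  fixes g :: "'a::euclidean_space \<Rightarrow> real"
  assumes \<mu>: "0 < \<mu>" and smooth: "L_smooth L g" and sc: "strongly_convex \<mu> g" and h: "closed_convex h"
    and sgo: "stochastic_gradient_oracle P G \<sigma> g"
    and pen: "0 \<le> pen" and \<epsilon>: "0 < \<epsilon>"
    and adm: "admissible_choices \<mu> L \<sigma> P G h m pen \<epsilon> c"
    and M: "M \<in> space (prob_algebra borel)"
    and success: "2 / 3 \<le> measure M {y. gap (prox_objective g h pen x\<^sub>c) y \<le> ereal \<epsilon>}"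
    and v: "(INF y. prox_objective g h pen x\<^sub>c y) = ereal v"
    and X: "X \<in> sets borel"
    and disjoint: "\<And>y xb. prox_objective g h pen x\<^sub>c xb = ereal v \<Longrightarrow>
      gap (prox_objective g h pen x\<^sub>c) y \<le> ereal (74 * ((L + pen) / (\<mu> + pen)) * \<epsilon>) \<Longrightarrow>
      norm (y - xb) \<le> 3 * sqrt (2 * \<epsilon> / (\<mu> + pen)) \<Longrightarrow> y \<notin> X"
  shows "emeasure (RobustGap \<mu> L \<sigma> P G h c pen M m \<epsilon> x\<^sub>c) X \<le> ennreal (2 * exp (- (real m / 18)))"
proof -
  interpret run: robust_gap_setup \<mu> L \<sigma> P G h m pen \<epsilon> c
    using sgo h adm by (rule robust_gap_setup_intro)
  show ?thesis
  proof (cases "0 < m")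
    case True
    let ?g = "\<lambda>y. g y + pen / 2 * (norm (y - x\<^sub>c))\<^sup>2"
    let ?D = "\<lambda>y. gradient g y + pen *\<^sub>R (y - x\<^sub>c)"
    interpret base: smooth_strongly_convex g "gradient g" \<mu> L
      using \<mu> smooth sc by (rule smooth_strongly_convex_gradient)
    interpret reg: smooth_strongly_convex ?g ?D "\<mu> + pen" "L + pen"
      using pen by (rule base.regularized)
    interpret comp: composite ?g ?D "\<mu> + pen" "L + pen" h
      by unfold_locales (rule h)
    have v': "(INF y. objective ?g h y) = ereal v" using v unfolding prox_objective_eq .
    obtain xb where xb: "objective ?g h xb = ereal v"
      by (rule comp.minimizer_exists[OF v'])
    \<comment> \<open>The radius for which the sample size is designed; choosing a center among the
      averages enlarges it to \<open>3 * a\<close>, as \<open>robust_gap_bound\<close>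
      expects.\<close>
    define a where "a = (L + pen) / (\<mu> + pen) * sqrt ((\<mu> + pen) * \<epsilon>)"
    have a: "0 \<le> a" using reg.L_pos reg.mu_pos \<epsilon> by (simp add: a_def)
    have mem: "w \<in> cball (?D x) a \<longleftrightarrow> norm (w - ?D x) \<le> a" for w x
      by (simp add: dist_norm norm_minus_commute)
    show ?thesis
    proof (rule run.RobustGap_bad_le[OF True M X, where A = "{y. gap (prox_objective g h pen x\<^sub>c) y \<le> ereal \<epsilon>}" and B = "\<lambda>x. cball (?D x) a"])
      show "{y. gap (prox_objective g h pen x\<^sub>c) y \<le> ereal \<epsilon>} \<in> sets borel"
        using measurable_sets[OF gap_prox_measurable[OF smooth h], of "{..ereal \<epsilon>}"] by (simp add: vimage_def)
      show "2 / 3 \<le> measure (PiM {..<run.N} (\<lambda>_. P)) {z \<in> space (PiM {..<run.N} (\<lambda>_. P)).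
          run.sample_average x\<^sub>c x z \<in> cball (?D x) a}" for x
        unfolding mem unfolding a_def using reg.L_pos reg.mu_pos \<epsilon>
        by (intro run.gradient_estimate_concentration[OF sgo]) auto
      fix u i Z k l
      assume maj: "m < 2 * card {k. k < m \<and> u k \<in> {y. gap (prox_objective g h pen x\<^sub>c) y \<le> ereal \<epsilon>}}"
        and i: "i \<in> Extract m rho_norm u"
        and maj': "m < 2 * card {k. k < m \<and> grad_average G pen x\<^sub>c run.N (u i) Z k \<in> cball (?D (u i)) a}"
        and k: "k \<in> center_set m (grad_average G pen x\<^sub>c run.N (u i) Z)"
        and l: "l \<in> Extract m rho_norm u" "l \<in> Extract m (rho_grad h (grad_average G pen x\<^sub>c run.N (u i) Z k)) u"
      have maj: "m < 2 * card {k. k < m \<and> gap (objective ?g h) (u k) \<le> ereal \<epsilon>}"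
        using maj unfolding prox_objective_eq mem_Collect_eq .
      have "norm (grad_average G pen x\<^sub>c run.N (u i) Z k - ?D (u i)) \<le> 3 * a"
        using maj' unfolding mem by (rule center_near_target[OF _ k a])
      then have "gap (objective ?g h) (u l) \<le> ereal (74 * ((L + pen) / (\<mu> + pen)) * \<epsilon>)"
        unfolding a_def by (rule comp.robust_gap_bound[OF v' xb maj i l])
      moreover have "norm (u l - xb) \<le> 3 * sqrt (2 * \<epsilon> / (\<mu> + pen))"
        by (rule comp.candidate_near_minimizer[OF v' xb maj l(1)])
      ultimately show "u l \<notin> X" 
        using disjoint[of xb "u l"] xb unfolding prox_objective_eq by blast
    qed (use success in auto)
  next
    case False
    then show ?thesis using run.RobustGap_zero[OF _ M] by simp
  qed
qed

text \<open>\<open>E\<close> bounds how far the minimal value of the current proximal problem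
  exceeds \<open>min f\<close>. The output inherits a gap for \<open>f\<close> itself and, for any
  next penalty \<open>p\<close>, a bound on the next proximal minimum. The bad set \<open>X\<close>
  is left open, so intermediate and final calls are both covered.\<close>

lemma boost_stage:
  fixes g :: "'a::euclidean_space \<Rightarrow> real"
  assumes \<mu>: "0 < \<mu>" and smooth: "L_smooth L g" and sc: "strongly_convex \<mu> g" and h: "closed_convex h"
    and sgo: "stochastic_gradient_oracle P G \<sigma> g" and alg: "alg_procedure g h Alg"
    and pen: "0 \<le> pen" and \<epsilon>: "0 < \<epsilon>" and \<Delta>: "0 < \<Delta>"
    and adm: "admissible_choices \<mu> L \<sigma> P G h m pen \<epsilon> c"
    and fs: "(INF y. objective g h y) = ereal fs"
    and gap: "gap (objective g h) x\<^sub>c \<le> ereal \<Delta>"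
    and env: "(INF y. prox_objective g h pen x\<^sub>c y) \<le> ereal (fs + E)"
    and X: "X \<in> sets borel"
    and disjoint: "\<And>y. gap (objective g h) y \<le> ereal (74 * ((L + pen) / (\<mu> + pen)) * \<epsilon> + E) \<Longrightarrow>
      (\<And>p. 0 \<le> p \<Longrightarrow> (INF z. prox_objective g h p y z) \<le> ereal (fs + (E + p * (9 * \<epsilon> / (\<mu> + pen))))) \<Longrightarrow> y \<notin> X"
  shows "emeasure (RobustGap \<mu> L \<sigma> P G h c pen (Alg \<epsilon> pen \<Delta> x\<^sub>c) m \<epsilon> x\<^sub>c) X \<le> ennreal (2 * exp (- (real m / 18)))"
proof -
  have le_prox: "objective g h y \<le> prox_objective g h p x y" if "0 \<le> p" for p x y
    using that by (auto simp: objective_def prox_objective_def intro!: add_right_mono)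
  have "ereal fs \<le> (INF y. prox_objective g h pen x\<^sub>c y)"
    unfolding fs[symmetric] by (intro INF_mono) (use le_prox[OF pen] in blast)
  with env obtain v where v: "(INF y. prox_objective g h pen x\<^sub>c y) = ereal v" "fs \<le> v" "v \<le> fs + E"
    by (cases "INF y. prox_objective g h pen x\<^sub>c y") auto
  \<comment> \<open>The penalty vanishes at its center and only raises the minimum, so a gap bound
    for \<open>f\<close> at the center is a valid input for the procedure.\<close>
  have "prox_objective g h pen x\<^sub>c x\<^sub>c = objective g h x\<^sub>c"
    by (simp add: prox_objective_def objective_def)
  also have "\<dots> \<le> ereal (fs + \<Delta>)" using gap by (simp add: gap_le_iff[OF fs])
  also have "\<dots> \<le> ereal (v + \<Delta>)" using v by simp
  finally have "gap (prox_objective g h pen x\<^sub>c) x\<^sub>c \<le> ereal \<Delta>"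
    by (simp add: gap_le_iff[OF v(1)])
  with alg pen \<epsilon> \<Delta> have success: "2 / 3 \<le> measure (Alg \<epsilon> pen \<Delta> x\<^sub>c) {y. gap (prox_objective g h pen x\<^sub>c) y \<le> ereal \<epsilon>}"
    and "Alg \<epsilon> pen \<Delta> \<in> borel \<rightarrow>\<^sub>M prob_algebra borel"
    by (auto simp: alg_procedure_def)
  then have M: "Alg \<epsilon> pen \<Delta> x\<^sub>c \<in> space (prob_algebra borel)"
    by (auto dest: measurable_space)
  show ?thesis
  proof (rule RobustGap_stage[OF \<mu> smooth sc h sgo pen \<epsilon> adm M success v(1) X], rule disjoint)
    fix y xb
    assume xb: "prox_objective g h pen x\<^sub>c xb = ereal v"
      and y: "gap (prox_objective g h pen x\<^sub>c) y \<le> ereal (74 * ((L + pen) / (\<mu> + pen)) * \<epsilon>)"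
      and near: "norm (y - xb) \<le> 3 * sqrt (2 * \<epsilon> / (\<mu> + pen))"
    have "objective g h y \<le> prox_objective g h pen x\<^sub>c y" by (rule le_prox[OF pen])
    also have "\<dots> \<le> ereal (v + 74 * ((L + pen) / (\<mu> + pen)) * \<epsilon>)" using y by (simp add: gap_le_iff[OF v(1)])
    also have "\<dots> \<le> ereal (fs + (74 * ((L + pen) / (\<mu> + pen)) * \<epsilon> + E))" using v by simp
    finally show "gap (objective g h) y \<le> ereal (74 * ((L + pen) / (\<mu> + pen)) * \<epsilon> + E)"
      by (simp add: gap_le_iff[OF fs])
    fix p :: real assume p: "0 \<le> p"
    have "(norm (y - xb))\<^sup>2 \<le> (3 * sqrt (2 * \<epsilon> / (\<mu> + pen)))\<^sup>2"
      using near by (intro power_mono) auto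
    also have "\<dots> = 18 * \<epsilon> / (\<mu> + pen)" using \<epsilon> \<mu> pen by (simp add: power_mult_distrib)
    finally have sq: "p / 2 * (norm (xb - y))\<^sup>2 \<le> p * (9 * \<epsilon> / (\<mu> + pen))"
      using mult_left_mono[of "(norm (y - xb))\<^sup>2" "18 * \<epsilon> / (\<mu> + pen)" "p / 2"] p
      by (simp add: norm_minus_commute mult_ac)
    \<comment> \<open>The minimizer of the current problem serves as competitor in the next one,
      whose center \<open>y\<close> is close to it.\<close>
    have "objective g h xb \<le> ereal v" using le_prox[OF pen, of xb x\<^sub>c] xb by simp
    then have "h xb \<le> ereal (v - g xb)" by (simp add: objective_le_iff)
    then have "prox_objective g h p y xb \<le> ereal (v + p / 2 * (norm (xb - y))\<^sup>2)"
      unfolding prox_objective_eq objective_le_iff by (simp add: algebra_simps)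
    also have "\<dots> \<le> ereal (fs + (E + p * (9 * \<epsilon> / (\<mu> + pen))))" using sq v by simp
    finally show "(INF z. prox_objective g h p y z) \<le> ereal (fs + (E + p * (9 * \<epsilon> / (\<mu> + pen))))"
      by (rule INF_lower2[OF UNIV_I])
  qed
qed

text \<open>The proof bounds the mass that \<open>B\<close> gives to the complement of
  \<open>good\<close>, for every \<open>m\<close>. Relative to the total mass this is the second
  conclusion; for odd \<open>m\<close> no mass is lost, which gives the first.\<close>

theorem theorem6p13:
  fixes g :: "'a::euclidean_space \<Rightarrow> real"
    and h :: "'a \<Rightarrow> ereal"
    and \<mu> L \<sigma> \<delta> \<Delta>in :: real
    and P :: "'z measure"
    and G :: "'a \<Rightarrow> 'z \<Rightarrow> 'a"
    and Alg :: "real \<Rightarrow> real \<Rightarrow> real \<Rightarrow> 'a \<Rightarrow> 'a measure"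
    and c :: "nat \<Rightarrow> ('a, 'z) choices"
    and lam :: "nat \<Rightarrow> real"
    and xin :: 'a
    and T m :: nat
  defines "B \<equiv> BoostAlgC \<mu> L \<sigma> P G h Alg c lam \<delta> \<Delta>in xin T m"
    and "good \<equiv> {y. gap (objective g h) y
                    \<le> ereal (\<delta> * (1 + (\<Sum>i\<le>T. lam i / (\<mu> + lam_prev lam i))))}"
    and "fail_prob \<equiv> 2 * (real T + 2) * exp (- (real m / 18))"
  assumes "0 < \<mu>"
    and "L_smooth L g"
    and "strongly_convex \<mu> g"
    and "closed_convex h"
    and "stochastic_gradient_oracle P G \<sigma> g"
    and "alg_procedure g h Alg"
    and "0 < \<Delta>in"
    and "gap (objective g h) xin \<le> ereal \<Delta>in"
    and "0 < \<delta>"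
    and "0 \<le> lam 0"
    and "\<And>i. i < T \<Longrightarrow> lam i \<le> lam (Suc i)"
    and "\<And>j. j \<le> T \<Longrightarrow> admissible_choices \<mu> L \<sigma> P G h m (lam_prev lam j) (\<delta> / 9) (c j)"
    and "admissible_choices \<mu> L \<sigma> P G h m (lam T) (final_accuracy \<mu> L \<delta> lam T) (c (T + 1))"
  shows "(odd m \<longrightarrow> measure B good \<ge> 1 - fail_prob) \<and>
         measure B good \<ge> measure B (space B) - fail_prob"
proof -
  note base = assms(4-8)
  interpret smooth_strongly_convex g "gradient g" \<mu> L
    using assms(4-6) by (rule smooth_strongly_convex_gradient)
  define q where "q = 2 * exp (- (real m / 18))"
  have q: "0 \<le> q" by (simp add: q_def)
  define E where "E j = \<delta> * (\<Sum>i<j. lam i / (\<mu> + lam_prev lam i))" for j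
  define law where "law = boost_iterate \<mu> L \<sigma> P G h Alg c lam \<delta> \<Delta>in xin m"
  obtain fs where fs: "(INF y. objective g h y) = ereal fs"
  proof (rule gap_leD[OF assms(11)])
    show "objective g h y \<noteq> -\<infinity>" for y
      using assms(7) by (auto simp: objective_def closed_convex_def)
  qed
  have lam_nonneg: "0 \<le> lam i" if "i \<le> T" for i
    using that by (induction i) (use assms(13,14) in \<open>auto intro: order_trans\<close>)
  have pen: "0 \<le> lam_prev lam j" if "j \<le> T + 1" for j
    using that lam_nonneg by (auto simp: lam_prev_def split: nat.split)
  have E_nonneg: "0 \<le> E j" if "j \<le> T + 1" for j
    unfolding E_def using that lam_nonneg pen assms(4,12)
    by (intro mult_nonneg_nonneg sum_nonneg divide_nonneg_nonneg add_nonneg_nonneg) auto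
  have Delta_eq: "Delta \<mu> L \<delta> lam j = 9 * ((L + lam_prev lam j) / (\<mu> + lam_prev lam j)) * \<delta> + E j" for j
    by (simp add: Delta_def E_def algebra_simps)
  have kappa_pos: "0 < (L + lam_prev lam j) / (\<mu> + lam_prev lam j)" if "j \<le> T + 1" for j
    using pen[OF that] mu_pos L_pos by simp
  have Delta_pos: "0 < Delta \<mu> L \<delta> lam j" if "j \<le> T + 1" for j
    unfolding Delta_eq using kappa_pos[OF that] E_nonneg[OF that] assms(12) by (intro add_pos_nonneg mult_pos_pos) auto
  have Delta_prev_pos: "0 < Delta_prev \<mu> L \<delta> \<Delta>in lam j" if "j \<le> T + 1" for j
    using that Delta_pos assms(10) by (auto simp: Delta_prev_def split: nat.split)

  \<comment> \<open>Invariant for the center \<open>x\<close> of call number \<open>j\<close>: the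
    first clause justifies the gap bound handed to \<open>Alg\<close>, the second limits by
    \<open>E j\<close> the accumulated drift of the proximal minimal values.\<close>
  define Inv where "Inv j x \<longleftrightarrow> gap (objective g h) x \<le> ereal (Delta_prev \<mu> L \<delta> \<Delta>in lam j) \<and>
    (INF y. prox_objective g h (lam_prev lam j) x y) \<le> ereal (fs + E j)" for j x
  have gap_meas [measurable]: "gap (objective g h) \<in> borel_measurable borel"
  proof -
    have "prox_objective g h 0 xin = objective g h" by (simp add: prox_objective_def objective_def fun_eq_iff)
    then show ?thesis using gap_prox_measurable[OF assms(5,7), of 0 xin] by simp
  qed
  have bad_set: "{x. \<not> Inv j x} \<in> sets borel" for j
  proof -
    note [measurable] = INF_prox_measurable[of g h "lam_prev lam j"]
    have "Measurable.pred borel (\<lambda>x. \<not> Inv j x)" unfolding Inv_def by measurable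
    then show ?thesis by (simp add: pred_def)
  qed
  have good_set: "good \<in> sets borel"
    unfolding good_def by measurable
  have run: "robust_gap_setup \<mu> L \<sigma> P G h m p \<epsilon> c'" if "admissible_choices \<mu> L \<sigma> P G h m p \<epsilon> c'" for p \<epsilon> c'
    using assms(8,7) that by (rule robust_gap_setup_intro)
  have alg: "Alg \<epsilon> p \<Delta> \<in> borel \<rightarrow>\<^sub>M prob_algebra borel" if "0 < \<epsilon>" "0 \<le> p" "0 < \<Delta>" for \<epsilon> p \<Delta>
    using assms(9) that by (simp add: alg_procedure_def)

  \<comment> \<open>The accuracy is left free and \<open>j = T + 1\<close> is included, so that the
    final call is covered too.\<close>
  have step: "emeasure (RobustGap \<mu> L \<sigma> P G h c' (lam_prev lam j) (Alg \<epsilon> (lam_prev lam j) (Delta_prev \<mu> L \<delta> \<Delta>in lam j) x) m \<epsilon> x) X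
      \<le> ennreal q"
    if "j \<le> T + 1" "0 < \<epsilon>" "admissible_choices \<mu> L \<sigma> P G h m (lam_prev lam j) \<epsilon> c'" "Inv j x" "X \<in> sets borel"
      "\<And>y. gap (objective g h) y \<le> ereal (74 * ((L + lam_prev lam j) / (\<mu> + lam_prev lam j)) * \<epsilon> + E j) \<Longrightarrow>
        (\<And>p. 0 \<le> p \<Longrightarrow> (INF z. prox_objective g h p y z) \<le> ereal (fs + (E j + p * (9 * \<epsilon> / (\<mu> + lam_prev lam j))))) \<Longrightarrow> y \<notin> X"
    for j \<epsilon> c' x X
    unfolding q_def
  proof (rule boost_stage[OF base assms(9) pen[OF that(1)] that(2) Delta_prev_pos[OF that(1)] that(3) fs _ _ that(5)])
    show "gap (objective g h) x \<le> ereal (Delta_prev \<mu> L \<delta> \<Delta>in lam j)"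
      "(INF y. prox_objective g h (lam_prev lam j) x y) \<le> ereal (fs + E j)"
      using that(4) by (simp_all add: Inv_def)
  qed (rule that(6))

  have iterate: "law j \<in> space (subprob_algebra borel) \<and> (odd m \<longrightarrow> prob_space (law j)) \<and>
      emeasure (law j) {x. \<not> Inv j x} \<le> ennreal (real j * q)" if "j \<le> T + 1" for j
    using that
  proof (induction j)
    case 0
    \<comment> \<open>The penalty with index -1 is 0, so the first problem is \<open>f\<close>
      itself and there is no drift yet.\<close>
    have "prox_objective g h 0 xin = objective g h" by (simp add: prox_objective_def objective_def fun_eq_iff)
    then have "Inv 0 xin" using assms(11) fs by (simp add: Inv_def Delta_prev_def lam_prev_def E_def)
    then show ?case
      using bad_set[of 0]
      by (simp add: law_def space_subprob_algebra prob_space_return prob_space_imp_subprob_space)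
  next
    case (Suc j)
    then have j: "j \<le> T" "j \<le> T + 1" by auto
    let ?K = "\<lambda>x. RobustGap \<mu> L \<sigma> P G h (c j) (lam_prev lam j) (Alg (\<delta> / 9) (lam_prev lam j) (Delta_prev \<mu> L \<delta> \<Delta>in lam j) x) m (\<delta> / 9) x"
    have IH: "law j \<in> space (subprob_algebra borel)" "odd m \<Longrightarrow> prob_space (law j)"
      "emeasure (law j) {x. \<not> Inv j x} \<le> ennreal (real j * q)"
      using Suc by auto
    have law_Suc: "law (Suc j) = law j \<bind> ?K" by (simp add: law_def)
    interpret R: robust_gap_setup \<mu> L \<sigma> P G h m "lam_prev lam j" "\<delta> / 9" "c j"
      using assms(15)[OF j(1)] by (rule run)
    have A: "Alg (\<delta> / 9) (lam_prev lam j) (Delta_prev \<mu> L \<delta> \<Delta>in lam j) \<in> borel \<rightarrow>\<^sub>M prob_algebra borel"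
      using assms(12) pen[OF j(2)] Delta_prev_pos[OF j(2)] by (intro alg) auto
    have K: "?K \<in> borel \<rightarrow>\<^sub>M subprob_algebra borel"
      by (rule R.RobustGap_measurable[OF A])
    have Kp: "prob_space (?K x)" if "odd m" for x
      using measurable_space[OF A] by (intro R.RobustGap_prob_space[OF that]) auto
    have sets: "sets (law j) = sets borel" and sub: "subprob_space (law j)"
      using IH(1) by (auto simp: space_subprob_algebra)
    have K': "?K \<in> law j \<rightarrow>\<^sub>M subprob_algebra borel" using K unfolding measurable_cong_sets[OF sets refl] .
    have "law (Suc j) \<in> space (subprob_algebra borel)"
      unfolding law_Suc using subprob_space_bind[OF sub K'] sets_bind_measurable[OF K' subprob_space.subprob_not_empty[OF sub]]
      by (simp add: space_subprob_algebra)
    moreover have "prob_space (law (Suc j))" if "odd m"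
      unfolding law_Suc using IH(2)[OF that] Kp[OF that] K' by (intro prob_space.prob_space_bind[where S = borel]) auto
    moreover have "emeasure (law (Suc j)) {x. \<not> Inv (Suc j) x} \<le> ennreal (real j * q) + ennreal q"
      unfolding law_Suc
    proof (rule emeasure_bind_le_bad_set[OF IH(1) K bad_set bad_set IH(3)])
      fix x assume "x \<notin> {x. \<not> Inv j x}"
      then have x: "Inv j x" by simp
      show "emeasure (?K x) {x. \<not> Inv (Suc j) x} \<le> ennreal q"
      proof (rule step[OF j(2) _ assms(15)[OF j(1)] x bad_set])
        fix y
        assume y: "gap (objective g h) y \<le> ereal (74 * ((L + lam_prev lam j) / (\<mu> + lam_prev lam j)) * (\<delta> / 9) + E j)"
          and env: "\<And>p. 0 \<le> p \<Longrightarrow> (INF z. prox_objective g h p y z) \<le> ereal (fs + (E j + p * (9 * (\<delta> / 9) / (\<mu> + lam_prev lam j))))"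
        \<comment> \<open>With accuracy \<open>\<delta> / 9\<close> the gap constant is 74/9, which
          is below the factor 9 in \<open>Delta\<close>; the comparison needs the common factor to
          be nonnegative.\<close>
        have "0 \<le> (L + lam_prev lam j) / (\<mu> + lam_prev lam j) * \<delta>"
          using kappa_pos[OF j(2)] assms(12) by (intro mult_nonneg_nonneg) auto
        then have "74 * ((L + lam_prev lam j) / (\<mu> + lam_prev lam j)) * (\<delta> / 9) + E j \<le> Delta \<mu> L \<delta> lam j"
          unfolding Delta_eq by argo
        with y have "gap (objective g h) y \<le> ereal (Delta \<mu> L \<delta> lam j)"
          by (meson ereal_less_eq(3) order_trans)
        \<comment> \<open>The accuracy \<open>\<delta> / 9\<close> cancels the 9 from the squared
          distance, so the drift grows by exactly one summand.\<close>
        moreover have "E (Suc j) = E j + lam j * (9 * (\<delta> / 9) / (\<mu> + lam_prev lam j))"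
          by (simp add: E_def algebra_simps)
        ultimately have "Inv (Suc j) y"
          using env[OF lam_nonneg[OF j(1)]] by (simp add: Inv_def Delta_prev_def lam_prev_def)
        then show "y \<notin> {x. \<not> Inv (Suc j) x}" by simp
      qed (use assms(12) in simp)
    qed
    moreover have "ennreal (real j * q) + ennreal q = ennreal (real (Suc j) * q)"
      using q by (simp add: algebra_simps flip: ennreal_plus)
    ultimately show ?case by simp
  qed

  define \<epsilon> where "\<epsilon> = final_accuracy \<mu> L \<delta> lam T"
  let ?K = "\<lambda>x. RobustGap \<mu> L \<sigma> P G h (c (T + 1)) (lam T) (Alg \<epsilon> (lam T) (Delta \<mu> L \<delta> lam T) x) m \<epsilon> x"
  have lamT: "0 \<le> lam T" by (rule lam_nonneg) simp
  have \<epsilon>: "0 < \<epsilon>" using lamT mu_pos L_pos assms(12) by (simp add: \<epsilon>_def final_accuracy_def)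
  have B: "B = law (T + 1) \<bind> ?K"
    unfolding B_def BoostAlgC_def law_def \<epsilon>_def Let_def ..
  interpret R: robust_gap_setup \<mu> L \<sigma> P G h m "lam T" \<epsilon> "c (T + 1)"
    unfolding \<epsilon>_def using assms(16) by (rule run)
  have A: "Alg \<epsilon> (lam T) (Delta \<mu> L \<delta> lam T) \<in> borel \<rightarrow>\<^sub>M prob_algebra borel"
    using \<epsilon> lamT Delta_pos[of T] by (intro alg) auto
  have K: "?K \<in> borel \<rightarrow>\<^sub>M subprob_algebra borel"
    by (rule R.RobustGap_measurable[OF A])
  have Kp: "prob_space (?K x)" if "odd m" for x
    using measurable_space[OF A] by (intro R.RobustGap_prob_space[OF that]) auto
  have IH: "law (T + 1) \<in> space (subprob_algebra borel)" "odd m \<Longrightarrow> prob_space (law (T + 1))"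
    "emeasure (law (T + 1)) {x. \<not> Inv (T + 1) x} \<le> ennreal (real (T + 1) * q)"
    using iterate[of "T + 1"] by auto
  have sets: "sets (law (T + 1)) = sets borel" and sub: "subprob_space (law (T + 1))"
    using IH(1) by (auto simp: space_subprob_algebra)
  have K': "?K \<in> law (T + 1) \<rightarrow>\<^sub>M subprob_algebra borel" using K unfolding measurable_cong_sets[OF sets refl] .
  interpret B: subprob_space B
    unfolding B by (rule subprob_space_bind[OF sub K'])
  have sets_B: "sets B = sets borel"
    unfolding B by (rule sets_bind_measurable[OF K' subprob_space.subprob_not_empty[OF sub]])
  have "emeasure B (- good) \<le> ennreal (real (T + 1) * q) + ennreal q"
    unfolding B
  proof (rule emeasure_bind_le_bad_set[OF IH(1) K _ bad_set IH(3)])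
    show "- good \<in> sets borel" using good_set by (metis sets.compl_sets space_borel Compl_eq_Diff_UNIV)
    fix x assume "x \<notin> {x. \<not> Inv (T + 1) x}"
    then have x: "Inv (T + 1) x" by simp
    have "emeasure (RobustGap \<mu> L \<sigma> P G h (c (T + 1)) (lam_prev lam (T + 1)) (Alg \<epsilon> (lam_prev lam (T + 1)) (Delta_prev \<mu> L \<delta> \<Delta>in lam (T + 1)) x) m \<epsilon> x) (- good) \<le> ennreal q"
    proof (rule step[OF _ \<epsilon> _ x])
      show "admissible_choices \<mu> L \<sigma> P G h m (lam_prev lam (T + 1)) \<epsilon> (c (T + 1))"
        using assms(16) by (simp add: lam_prev_def \<epsilon>_def)
      show "- good \<in> sets borel" by fact
      fix y
      assume y: "gap (objective g h) y \<le> ereal (74 * ((L + lam_prev lam (T + 1)) / (\<mu> + lam_prev lam (T + 1))) * \<epsilon> + E (T + 1))"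
      \<comment> \<open>The final accuracy is chosen to cancel both the constant 74 and the last
        condition number.\<close>
      have "74 * ((L + lam T) / (\<mu> + lam T)) * \<epsilon> = \<delta>"
        using lamT mu_pos L_pos by (simp add: \<epsilon>_def final_accuracy_def)
      moreover have "\<delta> + E (T + 1) = \<delta> * (1 + (\<Sum>i\<le>T. lam i / (\<mu> + lam_prev lam i)))"
        by (simp add: E_def lessThan_Suc_atMost distrib_left)
      ultimately show "y \<notin> - good" using y by (simp add: good_def lam_prev_def)
    qed simp
    then show "emeasure (?K x) (- good) \<le> ennreal q"
      by (simp add: lam_prev_def Delta_prev_def)
  qed
  \<comment> \<open>There are \<open>T + 1\<close> calls in the loop and one final call, each
    failing with probability at most \<open>q\<close>.\<close>
  also have "\<dots> = ennreal fail_prob"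
    unfolding fail_prob_def q_def by (simp add: algebra_simps flip: ennreal_plus)
  finally have bad: "measure B (- good) \<le> fail_prob"
    by (simp add: B.emeasure_eq_measure fail_prob_def)
  have "space B = UNIV" using sets_eq_imp_space_eq[OF sets_B] by simp
  moreover have "measure B (space B - good) = measure B (space B) - measure B good"
    using good_set sets_B by (intro B.finite_measure_compl) simp
  ultimately have *: "measure B (space B) - fail_prob \<le> measure B good"
    using bad by (simp add: Compl_eq_Diff_UNIV)
  moreover have "measure B (space B) = 1" if "odd m"
  proof -
    have "prob_space B"
      unfolding B using IH(2)[OF that] Kp[OF that] K' by (intro prob_space.prob_space_bind[where S = borel]) auto
    then show ?thesis by (rule prob_space.prob_space)
  qed
  ultimately show ?thesis by auto
qed

end
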